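(* Let $Q\in C^2(\mathbb T;\mathbb R)$ and $v(\theta)=Q(e^{i\theta})$. Fix $\eta>0$, suppose that $\eta_j\ge\eta$ for all $j=1,\dots,n$, and define $$f(\theta_1,\dots,\theta_n)=\frac1n\sum_{j=1}^n\frac{\sinh\eta_j}{\sinh^2(\eta_j/2)+\sin^2((x-\theta_j)/2)}.$$ There exists an absolute constant $\kappa_4>0$ such that for all $n$ and all $s>0$ $$\tilde\nu_n\Bigl\{\Theta\in\mathcal T^n:\Bigl|f(\Theta)-\int f\,d\tilde\nu_n\Bigr|\ge\frac{s}{\sqrt n}\Bigr\}\le2e^{-s^2/4\kappa_4}.$$
   Context: $\mathcal T^n$ is the $n$-dimensional torus (the maximal torus of the group $U(n)$ of $n\times n$ unitary matrices), with angular coordinates $\Theta=(\theta_1,\dots,\theta_n)\in[0,2\pi]^n$, and $x$ is a point of the circle $\mathbb T=\mathbb R/2\pi\mathbb Z$. $\tilde\nu_n$ is the probability measure on $\mathcal T^n$ $$\tilde\nu_n(d\Theta)=Z_n^{-1}e^{-\sum_{j=1}^nnv(\theta_j)}\prod_{1\le j<k\le n}4\sin^2\tfrac12(\theta_k-\theta_j)\;\frac{d\theta_1}{2\pi}\cdots\frac{d\theta_n}{2\pi},$$ with $Z_n$ the normalising constant. *)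

theory Defs
  imports "HOL-Probability.Probability"
begin

text \<open>A function on the circle is given as a function on the complex plane of which only the
  values on the unit circle matter; its smoothness is that of its pullback to the real line under
  the angular coordinate.\<close>

definition potential :: "(complex \<Rightarrow> real) \<Rightarrow> real \<Rightarrow> real" where
  "potential Q \<theta> = Q (cis \<theta>)"

definition C2_circle :: "(complex \<Rightarrow> real) \<Rightarrow> bool" where
  "C2_circle Q \<longleftrightarrow>
     (\<forall>t. potential Q differentiable (at t)) \<and>
     (\<forall>t. deriv (potential Q) differentiable (at t)) \<and>
     continuous_on UNIV (deriv (deriv (potential Q)))"

definition torus :: "nat \<Rightarrow> (nat \<Rightarrow> real) set" where
  "torus n = (\<Pi>\<^sub>E j\<in>{1..n}. {0..2 * pi})"

text \<open>The product of the measures \<open>d\<theta>\<^sub>j / 2\<pi>\<close> on \<open>[0, 2\<pi>]\<close>.  Its underlying space is all of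
  real n-space, but it is concentrated on \<^term>\<open>torus n\<close>.\<close>

definition haar_torus :: "nat \<Rightarrow> (nat \<Rightarrow> real) measure" where
  "haar_torus n = (\<Pi>\<^sub>M j\<in>{1..n}. uniform_measure lborel {0..2 * pi})"

definition ensemble_weight :: "(complex \<Rightarrow> real) \<Rightarrow> nat \<Rightarrow> (nat \<Rightarrow> real) \<Rightarrow> real" where
  "ensemble_weight Q n \<Theta> =
     exp (- (\<Sum>j=1..n. real n * potential Q (\<Theta> j))) *
     (\<Prod>k\<in>{1..n}. \<Prod>j\<in>{1..<k}. 4 * (sin ((\<Theta> k - \<Theta> j) / 2))\<^sup>2)"

definition partition_const :: "(complex \<Rightarrow> real) \<Rightarrow> nat \<Rightarrow> real" where
  "partition_const Q n = (\<integral>\<Theta>. ensemble_weight Q n \<Theta> \<partial>haar_torus n)"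

definition circular_ensemble :: "(complex \<Rightarrow> real) \<Rightarrow> nat \<Rightarrow> (nat \<Rightarrow> real) measure" where
  "circular_ensemble Q n =
     density (haar_torus n) (\<lambda>\<Theta>. ennreal (ensemble_weight Q n \<Theta> / partition_const Q n))"

definition poisson_average ::
  "nat \<Rightarrow> (nat \<Rightarrow> real) \<Rightarrow> real \<Rightarrow> (nat \<Rightarrow> real) \<Rightarrow> real" where
  "poisson_average n h x \<Theta> =
     (1 / real n) * (\<Sum>j=1..n. sinh (h j) / ((sinh (h j / 2))\<^sup>2 + (sin ((x - \<Theta> j) / 2))\<^sup>2))"

end

(*
  Revealing the particles one at a time reduces the claim to Hoeffding's lemma, provided that the
  conditional mean of a linear statistic given one particle lies in an interval that is the same for
  all positions of that particle and whose length depends on neither the potential nor n. Pinning a particle at a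
  turns the gas of n + 1 particles with weight w into a gas of n particles with weight
  w(y) |u(a) - u(y)|^2, so the argument is an induction over all weights. Its core is the negative
  correlation of determinantal processes: pinning removes a nonnegative density of total mass one
  from the one-particle intensity. This follows by comparing the reproducing kernel of the
  polynomials of degree at most n with that of the subspace vanishing at a; reproducing kernels are
  obtained as averages of products of linear factors, via Lagrange interpolation.
*)
theory Submission
  imports Defs "HOL-Computational_Algebra.Polynomial"
begin

subsection \<open>Bounded measurable functions\<close>

text \<open>No convexity of the potential is available, so the comparison must see the weight only
  through the inner product it defines; reproducing kernels do exactly that. A basis of orthonormal
  polynomials would have to be rebuilt for every pinned weight and breaks down for degenerate ones,
  whereas kernels obtained as averages are explicit in the weight. Degeneracy is a real concern: the
  pinned weight vanishes wherever \<open>u\<close> takes the value \<open>u a\<close>, so partition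
  functions may be 0 and weights are only assumed nonnegative. Constants: let the summands take
  values in [0, c]. Given one particle, the mean of the others is a fixed C minus an average of
  integrals of [0, c]-valued functions against densities of mass one, so it lies in [C - c, C].
  Adding the summand of the revealed particle gives a range of length 2c, and Hoeffding's lemma
  costs l^2 (2c)^2 / 8 = l^2 c^2 / 2 per particle. Optimising over l gives the tail exp(-t^2 / (2 n
  c^2)), in which t = s sqrt(n) cancels n.\<close>

text \<open>The bound is required on the whole type, not just almost everywhere or on the space. It
  therefore survives substitution, pinning of coordinates and integration over parameters, and gives
  integrability for every finite measure without side conditions.\<close>

definition bounded_measurable :: "'a measure \<Rightarrow> ('a \<Rightarrow> 'b::real_normed_vector) \<Rightarrow> bool" where
  "bounded_measurable N f \<longleftrightarrow> f \<in> borel_measurable N \<and> (\<exists>B. \<forall>x. norm (f x) \<le> B)"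

lemma bounded_measurableI:
  "f \<in> borel_measurable N \<Longrightarrow> (\<And>x. norm (f x) \<le> B) \<Longrightarrow> bounded_measurable N f"
  unfolding bounded_measurable_def by blast

lemma bounded_measurable_borel [measurable_dest]:
  "bounded_measurable N f \<Longrightarrow> f \<in> borel_measurable N"
  unfolding bounded_measurable_def by blast

lemma bounded_measurable_const [intro, simp]: "bounded_measurable N (\<lambda>x. c)"
  by (rule bounded_measurableI[where B = "norm c"]) auto

lemma bounded_measurable_compose:
  assumes "bounded_measurable N f" "g \<in> measurable N' N"
  shows "bounded_measurable N' (\<lambda>x. f (g x))"
  using assms measurable_compose[OF assms(2), of f borel]
  unfolding bounded_measurable_def by blast

lemma bounded_measurable_add:
  fixes f g :: "_ \<Rightarrow> 'b::{second_countable_topology, real_normed_vector}"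
  assumes "bounded_measurable N f" "bounded_measurable N g"
  shows "bounded_measurable N (\<lambda>x. f x + g x)"
proof -
  obtain A B where AB: "\<And>x. norm (f x) \<le> A" "\<And>x. norm (g x) \<le> B"
    using assms unfolding bounded_measurable_def by blast
  have [measurable]: "f \<in> borel_measurable N" "g \<in> borel_measurable N"
    using assms by (auto dest: bounded_measurable_borel)
  show ?thesis
    by (rule bounded_measurableI[where B = "A + B"])
       (measurable, blast intro: norm_triangle_mono AB)
qed

lemma bounded_measurable_mult:
  fixes f g :: "_ \<Rightarrow> 'b::{second_countable_topology, real_normed_algebra}"
  assumes "bounded_measurable N f" "bounded_measurable N g"
  shows "bounded_measurable N (\<lambda>x. f x * g x)"
proof -
  obtain A B where AB: "\<And>x. norm (f x) \<le> A" "\<And>x. norm (g x) \<le> B"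
    using assms unfolding bounded_measurable_def by blast
  have [measurable]: "f \<in> borel_measurable N" "g \<in> borel_measurable N"
    using assms by (auto dest: bounded_measurable_borel)
  show ?thesis
  proof (rule bounded_measurableI[where B = "A * B"])
    fix x
    have "norm (f x * g x) \<le> norm (f x) * norm (g x)" by (rule norm_mult_ineq)
    also have "\<dots> \<le> A * B"
      using AB[of x] norm_ge_zero[of "f x"] norm_ge_zero[of "g x"] by (intro mult_mono) linarith+
    finally show "norm (f x * g x) \<le> A * B" .
  qed measurable
qed

lemma bounded_measurable_bounded_linear:
  assumes "bounded_linear T" "bounded_measurable N f"
  shows "bounded_measurable N (\<lambda>x. T (f x))"
proof -
  interpret bounded_linear T by fact
  have "continuous_on UNIV T"
    using assms(1) by (intro linear_continuous_on)
  hence [measurable]: "T \<in> borel_measurable borel"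
    by (rule borel_measurable_continuous_onI)
  have [measurable]: "f \<in> borel_measurable N"
    using assms by (auto dest: bounded_measurable_borel)
  obtain A where A: "\<And>x. norm (f x) \<le> A"
    using assms unfolding bounded_measurable_def by blast
  obtain K where K: "\<And>x. norm (T x) \<le> norm x * K" "0 \<le> K" using nonneg_bounded by blast
  show ?thesis
    by (rule bounded_measurableI[where B = "A * K"])
       (measurable, meson A K order_trans mult_right_mono)
qed

lemma bounded_measurable_of_real:
  fixes f :: "_ \<Rightarrow> real"
  assumes "bounded_measurable N f"
  shows "bounded_measurable N (\<lambda>x. of_real (f x) :: 'b::real_normed_algebra_1)"
  by (rule bounded_measurable_bounded_linear[OF bounded_linear_of_real assms])

lemma bounded_measurable_cnj:
  assumes "bounded_measurable N f"
  shows "bounded_measurable N (\<lambda>x. cnj (f x))"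
  by (rule bounded_measurable_bounded_linear[OF bounded_linear_cnj assms])

lemma bounded_measurable_diff:
  fixes f g :: "_ \<Rightarrow> 'b::{second_countable_topology, real_normed_vector}"
  assumes "bounded_measurable N f" "bounded_measurable N g"
  shows "bounded_measurable N (\<lambda>x. f x - g x)"
proof -
  have "bounded_measurable N (\<lambda>x. f x + (- g x))"
    by (intro bounded_measurable_add assms
        bounded_measurable_bounded_linear[OF bounded_linear_minus[OF bounded_linear_ident]])
  thus ?thesis by simp
qed

lemma bounded_measurable_norm:
  assumes "bounded_measurable N f"
  shows "bounded_measurable N (\<lambda>x. norm (f x))"
  using assms unfolding bounded_measurable_def by auto

lemma bounded_measurable_sum:
  fixes f :: "_ \<Rightarrow> _ \<Rightarrow> 'b::{second_countable_topology, real_normed_vector}"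
  assumes "\<And>i. i \<in> I \<Longrightarrow> bounded_measurable N (f i)"
  shows "bounded_measurable N (\<lambda>x. \<Sum>i\<in>I. f i x)"
  using assms by (induction I rule: infinite_finite_induct) (auto intro: bounded_measurable_add)

lemma bounded_measurable_prod:
  fixes f :: "_ \<Rightarrow> _ \<Rightarrow> 'b::{second_countable_topology, real_normed_field}"
  assumes "\<And>i. i \<in> I \<Longrightarrow> bounded_measurable N (f i)"
  shows "bounded_measurable N (\<lambda>x. \<Prod>i\<in>I. f i x)"
  using assms by (induction I rule: infinite_finite_induct) (auto intro: bounded_measurable_mult)

lemma bounded_measurable_power:
  fixes f :: "_ \<Rightarrow> 'b::{second_countable_topology, real_normed_field}"
  assumes "bounded_measurable N f"
  shows "bounded_measurable N (\<lambda>x. f x ^ k)"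
  using assms by (induction k) (auto intro: bounded_measurable_mult)

lemma bounded_measurable_exp:
  assumes "bounded_measurable N f"
  shows "bounded_measurable N (\<lambda>x. exp (f x :: real))"
proof -
  obtain A where A: "\<And>x. norm (f x) \<le> A"
    using assms unfolding bounded_measurable_def by blast
  have [measurable]: "f \<in> borel_measurable N"
    using assms by (auto dest: bounded_measurable_borel)
  show ?thesis
  proof (rule bounded_measurableI[where B = "exp A"])
    show "norm (exp (f x)) \<le> exp A" for x using A[of x] by auto
  qed measurable
qed

lemma bounded_measurable_integrable:
  fixes f :: "_ \<Rightarrow> 'b::{banach, second_countable_topology}"
  assumes "finite_measure N" "bounded_measurable N f"
  shows "integrable N f"
  using assms finite_measure.integrable_const_bound[of N f]
  unfolding bounded_measurable_def by blast

lemma bounded_measurable_integral: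
  fixes f :: "_ \<Rightarrow> _ \<Rightarrow> 'b::{banach, second_countable_topology}"
  assumes "finite_measure P" "bounded_measurable (N \<Otimes>\<^sub>M P) (\<lambda>p. f (fst p) (snd p))"
  shows "bounded_measurable N (\<lambda>x. \<integral>y. f x y \<partial>P)"
proof -
  interpret finite_measure P by fact
  obtain B where B: "\<And>p. norm (f (fst p) (snd p)) \<le> B"
    using assms unfolding bounded_measurable_def by blast
  have B': "norm (f x y) \<le> B" for x y using B[of "(x, y)"] by simp
  have m: "(\<lambda>(x, y). f x y) \<in> borel_measurable (N \<Otimes>\<^sub>M P)"
    using bounded_measurable_borel[OF assms(2)] by (simp add: case_prod_unfold)
  show ?thesis
  proof (rule bounded_measurableI[where B = "B * measure P (space P)"])
    show "(\<lambda>x. \<integral>y. f x y \<partial>P) \<in> borel_measurable N"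
      by (rule borel_measurable_lebesgue_integral) (use m in simp)
    have B0: "0 \<le> B" using B' norm_ge_zero order_trans by blast
    show "norm (\<integral>y. f x y \<partial>P) \<le> B * measure P (space P)" for x
    \<comment> \<open>The bound is due for every \<open>x\<close> of the type; outside the space of
      \<open>N\<close> the section may fail to be integrable, and then the integral has the default
      value 0.\<close>
    proof (cases "integrable P (f x)")
      case True
      have "norm (\<integral>y. f x y \<partial>P) \<le> (\<integral>y. norm (f x y) \<partial>P)" by (rule integral_norm_bound)
      also have "\<dots> \<le> (\<integral>y. B \<partial>P)" by (intro integral_mono integrable_norm True) (auto simp: B')
      finally show ?thesis by (simp add: mult.commute)
    qed (simp add: not_integrable_integral_eq B0)
  qed
qed

lemmas bounded_measurable_intros =
  bounded_measurable_const bounded_measurable_add bounded_measurable_diff bounded_measurable_mult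
  bounded_measurable_of_real bounded_measurable_cnj bounded_measurable_norm
  bounded_measurable_sum bounded_measurable_prod bounded_measurable_power bounded_measurable_exp

subsection \<open>Weighted Vandermonde ensembles\<close>

locale vandermonde_gas = prob_space M for M :: "'a measure" +
  fixes u :: "'a \<Rightarrow> complex"
  assumes u_bounded_measurable: "bounded_measurable M u"
begin

abbreviation prodM :: "nat set \<Rightarrow> (nat \<Rightarrow> 'a) measure" where
  "prodM I \<equiv> \<Pi>\<^sub>M _\<in>I. M"

lemma prob_space_prodM: "prob_space (prodM I)"
  by (rule prob_space_PiM) (rule prob_space_axioms)

lemma finite_measure_prodM: "finite_measure (prodM I)"
  using prob_space_prodM prob_space.finite_measure by blast

lemma bounded_measurable_coord:
  assumes "bounded_measurable M f" "i \<in> I"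
  shows "bounded_measurable (prodM I) (\<lambda>\<xi>. f (\<xi> i))"
  using assms(2) by (intro bounded_measurable_compose[OF assms(1)]) measurable

text \<open>Fubini is used to put the new coordinate outermost, so that the inner integral is over
  the remaining particles with the revealed one held fixed.\<close>

lemma integral_prodM_insert:
  fixes f :: "(nat \<Rightarrow> 'a) \<Rightarrow> 'b::{banach, second_countable_topology}"
  assumes "finite I" "i \<notin> I" "bounded_measurable (prodM (insert i I)) f"
  shows "(\<integral>\<xi>. f \<xi> \<partial>prodM (insert i I)) = (\<integral>a. (\<integral>\<xi>. f (\<xi>(i := a)) \<partial>prodM I) \<partial>M)"
proof -
  interpret P: product_sigma_finite "\<lambda>_::nat. M"
    by (simp add: product_sigma_finite_def sigma_finite_measure_axioms)
  interpret PP: pair_prob_space "prodM I" M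
    by (simp add: pair_prob_space_def pair_sigma_finite_def prob_space_axioms prob_space_prodM
        prob_space_imp_sigma_finite)
  have "bounded_measurable (prodM I \<Otimes>\<^sub>M M) (\<lambda>p. f ((\<lambda>(\<xi>, a). \<xi>(i := a)) p))"
    by (rule bounded_measurable_compose[OF assms(3)]) (rule measurable_add_dim)
  hence int: "integrable (prodM I \<Otimes>\<^sub>M M) (\<lambda>(\<xi>, a). f (\<xi>(i := a)))"
    by (auto dest!: bounded_measurable_integrable[rotated] intro: PP.finite_measure
        simp: case_prod_unfold)
  have "(\<integral>\<xi>. f \<xi> \<partial>prodM (insert i I)) = (\<integral>\<xi>. (\<integral>a. f (\<xi>(i := a)) \<partial>M) \<partial>prodM I)"
    by (intro P.product_integral_insert assms
        bounded_measurable_integrable[OF finite_measure_prodM])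
  also have "\<dots> = (\<integral>a. (\<integral>\<xi>. f (\<xi>(i := a)) \<partial>prodM I) \<partial>M)"
    by (rule PP.Fubini_integral[symmetric]) (use int in simp)
  finally show ?thesis .
qed

text \<open>The product runs over ordered pairs, so every pair of particles enters twice. This is
  the squared modulus of the Vandermonde determinant, written without an order on the index
  set.\<close>

definition vdm_sq :: "nat set \<Rightarrow> (nat \<Rightarrow> 'a) \<Rightarrow> real" where
  "vdm_sq I \<xi> = (\<Prod>i\<in>I. \<Prod>j\<in>I - {i}. norm (u (\<xi> i) - u (\<xi> j)))"

text \<open>The weight takes values in a field because two kinds are needed: nonnegative real
  weights for the gas itself and complex ones for its kernels.\<close>

definition gas_weight :: "nat set \<Rightarrow> ('a \<Rightarrow> 'b) \<Rightarrow> (nat \<Rightarrow> 'a) \<Rightarrow> 'b::real_normed_field" where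
  "gas_weight I w \<xi> = (\<Prod>i\<in>I. w (\<xi> i)) * of_real (vdm_sq I \<xi>)"

definition gas_partition :: "nat set \<Rightarrow> ('a \<Rightarrow> 'b) \<Rightarrow> 'b::{real_normed_field, banach, second_countable_topology}" where
  "gas_partition I w = (\<integral>\<xi>. gas_weight I w \<xi> \<partial>prodM I)"

definition tilt :: "('a \<Rightarrow> 'b) \<Rightarrow> 'a \<Rightarrow> 'a \<Rightarrow> 'b::real_normed_field" where
  "tilt w a y = w y * of_real ((norm (u a - u y))\<^sup>2)"

text \<open>The new index occurs once as the first and once as the second entry of a pair with each
  old index, hence the squares.\<close>

lemma vdm_sq_insert:
  assumes "finite I" "i \<notin> I"
  shows "vdm_sq (insert i I) (\<xi>(i := a)) = vdm_sq I \<xi> * (\<Prod>j\<in>I. (norm (u a - u (\<xi> j)))\<^sup>2)"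
proof -
  let ?d = "\<lambda>\<xi> i j. norm (u (\<xi> i) - u (\<xi> j))"
  have *: "(\<Prod>j\<in>insert i I - {k}. ?d (\<xi>(i := a)) k j) =
           norm (u a - u (\<xi> k)) * (\<Prod>j\<in>I - {k}. ?d \<xi> k j)" if "k \<in> I" for k
  proof -
    have "insert i I - {k} = insert i (I - {k})" "k \<noteq> i" using that assms by auto
    moreover have "(\<Prod>j\<in>I - {k}. ?d (\<xi>(i := a)) k j) = (\<Prod>j\<in>I - {k}. ?d \<xi> k j)"
      using that assms by (intro prod.cong) auto
    ultimately show ?thesis using assms by (simp add: norm_minus_commute)
  qed
  have "vdm_sq (insert i I) (\<xi>(i := a)) =
      (\<Prod>j\<in>I. ?d (\<xi>(i := a)) i j) * (\<Prod>k\<in>I. norm (u a - u (\<xi> k)) * (\<Prod>j\<in>I - {k}. ?d \<xi> k j))"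
  proof -
    have "insert i I - {i} = I" using assms by auto
    thus ?thesis
      unfolding vdm_sq_def using assms by (subst prod.insert) (simp_all only: * simp_thms cong: prod.cong)
  qed
  also have "(\<Prod>j\<in>I. ?d (\<xi>(i := a)) i j) = (\<Prod>j\<in>I. norm (u a - u (\<xi> j)))"
    using assms by (intro prod.cong) auto
  finally show ?thesis
    by (simp add: vdm_sq_def prod.distrib power2_eq_square)
qed

lemma gas_weight_insert:
  assumes "finite I" "i \<notin> I"
  shows "gas_weight (insert i I) w (\<xi>(i := a)) = w a * gas_weight I (tilt w a) \<xi>"
proof -
  have "(\<Prod>j\<in>I. w ((\<xi>(i := a)) j)) = (\<Prod>j\<in>I. w (\<xi> j))"
    using assms by (intro prod.cong) auto
  thus ?thesis
    using assms by (simp add: gas_weight_def vdm_sq_insert tilt_def prod.distrib)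
qed

lemma bounded_measurable_vdm_sq: "bounded_measurable (prodM I) (vdm_sq I)"
  unfolding vdm_sq_def[abs_def]
  by (intro bounded_measurable_intros bounded_measurable_coord u_bounded_measurable) auto

lemma bounded_measurable_gas_weight:
  fixes w :: "'a \<Rightarrow> 'b::{real_normed_field, second_countable_topology}"
  assumes "bounded_measurable M w"
  shows "bounded_measurable (prodM I) (gas_weight I w)"
  unfolding gas_weight_def[abs_def]
  by (intro bounded_measurable_intros bounded_measurable_coord bounded_measurable_vdm_sq assms)

lemma bounded_measurable_tilt:
  fixes w :: "'a \<Rightarrow> 'b::{real_normed_field, second_countable_topology}"
  assumes "bounded_measurable M w"
  shows "bounded_measurable M (tilt w a)"
  unfolding tilt_def[abs_def]
  by (intro bounded_measurable_intros u_bounded_measurable assms)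

text \<open>The factor \<open>q\<close> lets one statement serve partition functions and kernels
  (\<open>q\<close> = 1), conditional means (\<open>q\<close> a linear statistic) and conditional
  exponential moments.\<close>

lemma bounded_measurable_gas_partition_param:
  fixes w :: "'c \<Rightarrow> 'a \<Rightarrow> 'b::{real_normed_field, banach, second_countable_topology}"
    and q :: "(nat \<Rightarrow> 'a) \<Rightarrow> 'b"
  assumes "bounded_measurable (N \<Otimes>\<^sub>M M) (\<lambda>p. w (fst p) (snd p))" "bounded_measurable (prodM I) q"
  shows "bounded_measurable N (\<lambda>x. \<integral>\<xi>. gas_weight I (w x) \<xi> * q \<xi> \<partial>prodM I)"
proof (rule bounded_measurable_integral[OF finite_measure_prodM])
  have "bounded_measurable (N \<Otimes>\<^sub>M prodM I) (\<lambda>p. w (fst p) (snd p i))" if "i \<in> I" for i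
    using bounded_measurable_compose[OF assms(1), of "\<lambda>p. (fst p, snd p i)" "N \<Otimes>\<^sub>M prodM I"] that
    by simp
  moreover have "bounded_measurable (N \<Otimes>\<^sub>M prodM I) (\<lambda>p. vdm_sq I (snd p))"
    by (rule bounded_measurable_compose[OF bounded_measurable_vdm_sq]) simp
  moreover have "bounded_measurable (N \<Otimes>\<^sub>M prodM I) (\<lambda>p. q (snd p))"
    by (rule bounded_measurable_compose[OF assms(2)]) simp
  ultimately show "bounded_measurable (N \<Otimes>\<^sub>M prodM I) (\<lambda>p. gas_weight I (w (fst p)) (snd p) * q (snd p))"
    unfolding gas_weight_def by (intro bounded_measurable_intros)
qed

lemma bounded_measurable_tilt_pair:
  fixes w :: "'a \<Rightarrow> 'b::{real_normed_field, second_countable_topology}"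
  assumes "bounded_measurable M w"
  shows "bounded_measurable (M \<Otimes>\<^sub>M M) (\<lambda>p. tilt w (fst p) (snd p))"
  unfolding tilt_def
  by (intro bounded_measurable_intros bounded_measurable_compose[OF assms]
        bounded_measurable_compose[OF u_bounded_measurable]) auto

lemma bounded_measurable_gas_partition_tilt:
  fixes w :: "'a \<Rightarrow> 'b::{real_normed_field, banach, second_countable_topology}"
  assumes "bounded_measurable M w"
  shows "bounded_measurable M (\<lambda>a. gas_partition I (tilt w a))"
  using bounded_measurable_gas_partition_param[OF bounded_measurable_tilt_pair[OF assms], of I "\<lambda>_. 1"]
  by (simp add: gas_partition_def)

lemma gas_partition_empty [simp]: "gas_partition {} w = 1"
proof -
  interpret E: prob_space "prodM {}" by (rule prob_space_prodM)
  show ?thesis by (simp add: gas_partition_def gas_weight_def vdm_sq_def E.prob_space)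
qed

lemma gas_partition_insert:
  assumes "finite I" "i \<notin> I" "bounded_measurable M w"
  shows "gas_partition (insert i I) w = (\<integral>a. w a * gas_partition I (tilt w a) \<partial>M)"
  unfolding gas_partition_def
  by (subst integral_prodM_insert[OF assms(1,2) bounded_measurable_gas_weight[OF assms(3)]])
     (simp add: gas_weight_insert assms)

text \<open>Exchangeability of the particles, proved by revealing one particle on each side; the
  weight is generalised because revealing tilts it. It identifies the gases left over when different
  particles are removed from the same index set.\<close>

lemma gas_partition_card_cong:
  assumes "finite I" "finite J" "card I = card J" "bounded_measurable M w"
  shows "gas_partition I w = gas_partition J w"
  using assms
proof (induction I arbitrary: J w rule: finite_induct)
  case empty
  thus ?case by auto
next
  case (insert i I)
  then obtain j J' where J: "J = insert j J'" "j \<notin> J'" "card J' = card I"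
    by (metis card_insert_disjoint card_Suc_eq)
  hence "gas_partition I (tilt w a) = gas_partition J' (tilt w a)" for a
    using insert by (intro insert.IH bounded_measurable_tilt) auto
  thus ?case using insert J by (simp add: gas_partition_insert)
qed

lemma gas_partition_of_real: "gas_partition I (\<lambda>y. of_real (w y)) = (of_real (gas_partition I w) :: complex)"
proof -
  have "gas_weight I (\<lambda>y. of_real (w y)) = (\<lambda>\<xi>. of_real (gas_weight I w \<xi>) :: complex)"
    by (simp add: gas_weight_def fun_eq_iff)
  thus ?thesis unfolding gas_partition_def by simp
qed

lemma gas_partition_cnj: "gas_partition I (\<lambda>y. cnj (w y)) = cnj (gas_partition I w)"
proof -
  have "gas_weight I (\<lambda>y. cnj (w y)) = (\<lambda>\<xi>. cnj (gas_weight I w \<xi>))"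
    by (simp add: gas_weight_def fun_eq_iff)
  thus ?thesis unfolding gas_partition_def by simp
qed

lemma gas_weight_nonneg:
  fixes w :: "'a \<Rightarrow> real"
  assumes "\<And>x. 0 \<le> w x"
  shows "0 \<le> gas_weight I w \<xi>"
  unfolding gas_weight_def vdm_sq_def by (auto intro!: mult_nonneg_nonneg prod_nonneg assms)

lemma gas_partition_nonneg:
  fixes w :: "'a \<Rightarrow> real"
  assumes "\<And>x. 0 \<le> w x"
  shows "0 \<le> gas_partition I w"
  unfolding gas_partition_def by (intro Bochner_Integration.integral_nonneg gas_weight_nonneg assms)

lemma tilt_nonneg:
  fixes w :: "'a \<Rightarrow> real"
  assumes "\<And>x. 0 \<le> w x"
  shows "0 \<le> tilt w a x"
  unfolding tilt_def by (simp add: assms)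

text \<open>The factor next to \<open>q a\<close> on the right is the unnormalised density of
  particle \<open>j\<close>. Means of linear statistics thereby become integrals against
  one-particle densities.\<close>

lemma integral_coord_gas_weight:
  fixes w :: "'a \<Rightarrow> 'b::{real_normed_field, banach, second_countable_topology}"
  assumes "finite I" "j \<in> I" "bounded_measurable M w" "bounded_measurable M q"
  shows "(\<integral>\<xi>. q (\<xi> j) * gas_weight I w \<xi> \<partial>prodM I) =
         (\<integral>a. q a * w a * gas_partition (I - {j}) (tilt w a) \<partial>M)"
proof -
  have I: "I = insert j (I - {j})" using assms by auto
  have bm: "bounded_measurable (prodM (insert j (I - {j}))) (\<lambda>\<xi>. q (\<xi> j) * gas_weight I w \<xi>)"
    using I bounded_measurable_gas_weight[OF assms(3), of I] assms
    by (auto intro!: bounded_measurable_mult bounded_measurable_coord)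
  have "(\<integral>\<xi>. q (\<xi> j) * gas_weight I w \<xi> \<partial>prodM I) =
        (\<integral>\<xi>. q (\<xi> j) * gas_weight I w \<xi> \<partial>prodM (insert j (I - {j})))"
    using I by simp
  also have "\<dots> = (\<integral>a. (\<integral>\<xi>. q a * gas_weight I w (\<xi>(j := a)) \<partial>prodM (I - {j})) \<partial>M)"
    by (subst integral_prodM_insert[OF _ _ bm]) (use assms in auto)
  also have "\<dots> = (\<integral>a. q a * w a * gas_partition (I - {j}) (tilt w a) \<partial>M)"
  proof -
    have "gas_weight I w (\<xi>(j := a)) = w a * gas_weight (I - {j}) (tilt w a) \<xi>" for \<xi> a
      using gas_weight_insert[of "I - {j}" j w \<xi> a] assms insert_Diff[OF assms(2)] by simp
    thus ?thesis by (simp add: gas_partition_def mult.assoc)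
  qed
  finally show ?thesis .
qed

end

subsection \<open>Reproducing kernels\<close>

lemma poly_lagrange_interpolation:
  fixes p :: "'b::field poly" and y :: "'i \<Rightarrow> 'b"
  assumes "finite S" "inj_on y S" "degree p < card S"
  shows "poly p x = (\<Sum>j\<in>S. poly p (y j) * (\<Prod>i\<in>S - {j}. (x - y i) / (y j - y i)))"
proof -
  define l where "l j = (\<Prod>i\<in>S - {j}. [:- y i / (y j - y i), 1 / (y j - y i):])" for j
  have l: "poly (l j) x = (\<Prod>i\<in>S - {j}. (x - y i) / (y j - y i))" for j x
    by (simp add: l_def poly_prod diff_divide_distrib)
  have deg_l: "degree (l j) < card S" if "j \<in> S" for j
  proof -
    have "degree (l j) \<le> (\<Sum>i\<in>S - {j}. degree [:- y i / (y j - y i), 1 / (y j - y i):])"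
      unfolding l_def using assms by (intro degree_prod_sum_le[unfolded o_def, THEN order_trans]) auto
    also have "\<dots> \<le> (\<Sum>i\<in>S - {j}. 1)" by (intro sum_mono) auto
    also have "\<dots> < card S" using that assms by (simp add: card_gt_0_iff)
    finally show ?thesis .
  qed
  have "p = (\<Sum>j\<in>S. smult (poly p (y j)) (l j))" (is "p = ?q")
  proof (rule poly_eqI_degree[where A = "y ` S"])
    fix z assume "z \<in> y ` S"
    then obtain k where k: "k \<in> S" "z = y k" by blast
    have "poly (l j) (y k) = (if j = k then 1 else 0)" if "j \<in> S" for j
    proof (cases "j = k")
      case True
      have "y k - y i \<noteq> 0" if "i \<in> S - {k}" for i
        using assms(2) k that by (auto dest: inj_onD)
      thus ?thesis using True by (simp add: l)
    next
      case False
      hence "\<exists>i\<in>S - {j}. (y k - y i) / (y j - y i) = 0"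
        using k by (intro bexI[of _ k]) auto
      thus ?thesis using False assms by (simp add: l prod_zero)
    qed
    hence "poly ?q (y k) = (\<Sum>j\<in>S. poly p (y j) * (if j = k then 1 else 0))"
      by (simp add: poly_sum)
    thus "poly p z = poly ?q z" using k assms by (simp add: if_distrib[of "(*) _"] cong: if_cong)
  next
    show "degree p < card (y ` S)" using assms by (simp add: card_image)
    have "degree ?q \<le> card S - 1"
    proof (rule degree_sum_le)
      show "degree (smult (poly p (y j)) (l j)) \<le> card S - 1" if "j \<in> S" for j
        using degree_smult_le[of "poly p (y j)" "l j"] deg_l[OF that] by linarith
    qed fact
    thus "degree ?q < card (y ` S)" using assms by (simp add: card_image)
  qed
  hence "poly p x = poly ?q x" by simp
  thus ?thesis by (simp add: poly_sum l)
qed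

context vandermonde_gas
begin

text \<open>Membership in the span of the powers of \<open>u\<close> up to \<open>n\<close> is expressed by Lagrange
  interpolation, since this identity visibly passes to integrals over parameters.\<close>

definition interpolable :: "nat \<Rightarrow> ('a \<Rightarrow> complex) \<Rightarrow> bool" where
  "interpolable n q \<longleftrightarrow> (\<forall>S (\<xi> :: nat \<Rightarrow> 'a) x. card S = Suc n \<longrightarrow> inj_on (\<lambda>i. u (\<xi> i)) S \<longrightarrow>
     q x = (\<Sum>j\<in>S. q (\<xi> j) * (\<Prod>i\<in>S - {j}. (u x - u (\<xi> i)) / (u (\<xi> j) - u (\<xi> i)))))"

lemma interpolable_poly:
  assumes "degree p \<le> n"
  shows "interpolable n (\<lambda>z. poly p (u z))"
  unfolding interpolable_def
proof (intro allI impI)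
  fix S :: "nat set" and \<xi> :: "nat \<Rightarrow> 'a" and x
  assume S: "card S = Suc n" "inj_on (\<lambda>i. u (\<xi> i)) S"
  have "finite S" using S by (intro card_ge_0_finite) simp
  thus "poly p (u x) =
    (\<Sum>j\<in>S. poly p (u (\<xi> j)) * (\<Prod>i\<in>S - {j}. (u x - u (\<xi> i)) / (u (\<xi> j) - u (\<xi> i))))"
    using poly_lagrange_interpolation[of S "\<lambda>i. u (\<xi> i)" p "u x"] S assms
    by auto
qed

lemma interpolable_integral:
  assumes "\<And>\<xi>. interpolable n (F \<xi>)" "\<And>z. integrable N (\<lambda>\<xi>. F \<xi> z)"
  shows "interpolable n (\<lambda>z. \<integral>\<xi>. F \<xi> z \<partial>N)"
  unfolding interpolable_def
proof (intro allI impI)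
  fix S :: "nat set" and \<xi> :: "nat \<Rightarrow> 'a" and x
  assume S: "card S = Suc n" "inj_on (\<lambda>i. u (\<xi> i)) S"
  let ?c = "\<lambda>j. \<Prod>i\<in>S - {j}. (u x - u (\<xi> i)) / (u (\<xi> j) - u (\<xi> i))"
  have "(\<integral>\<zeta>. F \<zeta> x \<partial>N) = (\<integral>\<zeta>. (\<Sum>j\<in>S. F \<zeta> (\<xi> j) * ?c j) \<partial>N)"
    using assms(1) S unfolding interpolable_def
    by (intro Bochner_Integration.integral_cong) blast+
  also have "\<dots> = (\<Sum>j\<in>S. (\<integral>\<zeta>. F \<zeta> (\<xi> j) \<partial>N) * ?c j)"
    by (subst Bochner_Integration.integral_sum) (auto intro: assms(2))
  finally show "(\<integral>\<zeta>. F \<zeta> x \<partial>N) = (\<Sum>j\<in>S. (\<integral>\<zeta>. F \<zeta> (\<xi> j) \<partial>N) * ?c j)" .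
qed

section \<open>Averages of products of linear factors as kernels\<close>

text \<open>Up to a constant this is the reproducing kernel, in L^2 with weight \<open>w\<close>, of
  the polynomials in \<open>u\<close> of degree at most \<open>card I\<close>: a polynomial in
  \<open>u x\<close> and the conjugate of a polynomial in \<open>u z\<close>. The constant appears
  in \<open>gas_kernel_reproducing\<close>.\<close>

definition gas_kernel :: "nat set \<Rightarrow> ('a \<Rightarrow> real) \<Rightarrow> 'a \<Rightarrow> 'a \<Rightarrow> complex" where
  "gas_kernel I w x z = gas_partition I (\<lambda>y. of_real (w y) * (u x - u y) * cnj (u z - u y))"

lemma bounded_measurable_gas_kernel:
  assumes "bounded_measurable M w"
  shows "bounded_measurable M (\<lambda>z. gas_kernel I w z x)"
proof -
  have "bounded_measurable (M \<Otimes>\<^sub>M M)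
          (\<lambda>p. of_real (w (snd p)) * (u (fst p) - u (snd p)) * cnj (u x - u (snd p)))"
    by (intro bounded_measurable_intros bounded_measurable_compose[OF assms]
        bounded_measurable_compose[OF u_bounded_measurable]) auto
  from bounded_measurable_gas_partition_param[OF this, of I "\<lambda>_. 1"]
  show ?thesis by (simp add: gas_kernel_def gas_partition_def)
qed

lemma gas_kernel_hermitian: "gas_kernel I w z x = cnj (gas_kernel I w x z)"
  unfolding gas_kernel_def by (subst gas_partition_cnj[symmetric]) (simp add: mult_ac)

text \<open>On the diagonal each pair of conjugate factors becomes a squared distance, that is, a
  pinned particle at \<open>x\<close>. This links kernels to one-particle densities.\<close>

lemma gas_kernel_diag: "gas_kernel I w x x = of_real (gas_partition I (tilt w x))"
proof -
  have "(\<lambda>y. of_real (w y) * (u x - u y) * cnj (u x - u y)) = (\<lambda>y. of_real (tilt w x y))"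
    by (simp add: fun_eq_iff tilt_def mult.assoc complex_norm_square[symmetric] del: complex_cnj_diff)
  thus ?thesis by (simp add: gas_kernel_def gas_partition_of_real del: complex_cnj_diff)
qed

text \<open>With the particles frozen, the integrand is a constant times \<open>p\<close> times one
  linear factor per particle, a polynomial in \<open>u z\<close> of controlled degree; integrating
  over the particles preserves interpolability. The factor \<open>p\<close> is there to impose a
  zero at a pinned position later on.\<close>

lemma interpolable_poly_gas_kernel:
  assumes "degree p + card I \<le> n" "bounded_measurable M w"
  shows "interpolable n (\<lambda>z. poly p (u z) * gas_kernel I w z x)"
proof -
  let ?c = "\<lambda>\<xi>. (\<Prod>i\<in>I. of_real (w (\<xi> i)) * cnj (u x - u (\<xi> i))) * of_real (vdm_sq I \<xi>)"
  let ?P = "\<lambda>\<xi>. smult (?c \<xi>) (p * (\<Prod>i\<in>I. [:- u (\<xi> i), 1:]))"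
  have P: "poly (?P \<xi>) (u z) =
      poly p (u z) * gas_weight I (\<lambda>y. of_real (w y) * (u z - u y) * cnj (u x - u y)) \<xi>" for \<xi> z
    by (simp add: gas_weight_def poly_prod prod.distrib mult_ac)
  have "degree (?P \<xi>) \<le> n" for \<xi>
  proof -
    have "degree (\<Prod>i\<in>I. [:- u (\<xi> i), 1:]) \<le> card I"
      by (cases "finite I")
         (use degree_prod_sum_le[of I "\<lambda>i. [:- u (\<xi> i), 1:]"] in auto)
    hence "degree (p * (\<Prod>i\<in>I. [:- u (\<xi> i), 1:])) \<le> n"
      using degree_mult_le[of p "\<Prod>i\<in>I. [:- u (\<xi> i), 1:]"] assms(1) by linarith
    thus ?thesis using degree_smult_le[of "?c \<xi>"] order_trans by blast
  qed
  moreover have "integrable (prodM I) (\<lambda>\<xi>. poly (?P \<xi>) (u z))" for z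
    unfolding P
    by (intro bounded_measurable_integrable[OF finite_measure_prodM] bounded_measurable_intros
        bounded_measurable_gas_weight assms u_bounded_measurable)
  ultimately have "interpolable n (\<lambda>z. \<integral>\<xi>. poly (?P \<xi>) (u z) \<partial>prodM I)"
    by (intro interpolable_integral interpolable_poly) auto
  thus ?thesis unfolding P by (simp add: gas_kernel_def gas_partition_def)
qed

lemma vdm_sq_remove:
  assumes "finite S" "j \<in> S"
  shows "vdm_sq S \<xi> = vdm_sq (S - {j}) \<xi> * (\<Prod>i\<in>S - {j}. (norm (u (\<xi> j) - u (\<xi> i)))\<^sup>2)"
  using vdm_sq_insert[of "S - {j}" j \<xi> "\<xi> j"] assms by (simp add: insert_absorb)

lemma vdm_sq_eq_0:
  assumes "finite S" "i \<in> S" "j \<in> S" "i \<noteq> j" "u (\<xi> i) = u (\<xi> j)"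
  shows "vdm_sq S \<xi> = 0"
  unfolding vdm_sq_def using assms
  by (intro prod_zero bexI[of _ i] bexI[of _ j]) auto

lemma gas_weight_fun_upd:
  assumes "j \<notin> I"
  shows "gas_weight I w (\<xi>(j := a)) = gas_weight I w \<xi>"
proof -
  have "vdm_sq I (\<xi>(j := a)) = vdm_sq I \<xi>"
    unfolding vdm_sq_def using assms by (intro prod.cong) auto
  moreover have "(\<Prod>i\<in>I. w ((\<xi>(j := a)) i)) = (\<Prod>i\<in>I. w (\<xi> i))"
    using assms by (intro prod.cong) auto
  ultimately show ?thesis by (simp add: gas_weight_def)
qed

text \<open>Multiplying Lagrange interpolation by the squared Vandermonde determinant clears the
  denominators, so that coinciding nodes are covered as well.\<close>

lemma interpolable_gas_weight:
  assumes "card S = Suc n" "interpolable n q"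
  shows "q x * gas_weight S (\<lambda>y. of_real (w y)) \<xi> =
    (\<Sum>j\<in>S. q (\<xi> j) * of_real (w (\<xi> j)) *
      gas_weight (S - {j}) (\<lambda>y. of_real (w y) * (u x - u y) * cnj (u (\<xi> j) - u y)) \<xi>)"
proof -
  have fin: "finite S" using assms(1) by (intro card_ge_0_finite) simp
  show ?thesis
  proof (cases "inj_on (\<lambda>i. u (\<xi> i)) S")
    case True
    have "q x * gas_weight S (\<lambda>y. of_real (w y)) \<xi> =
      (\<Sum>j\<in>S. q (\<xi> j) * (\<Prod>i\<in>S - {j}. (u x - u (\<xi> i)) / (u (\<xi> j) - u (\<xi> i)))
         * gas_weight S (\<lambda>y. of_real (w y)) \<xi>)"
      unfolding sum_distrib_right[symmetric]
      using assms(2)[unfolded interpolable_def, rule_format, OF assms(1) True, of x] by (rule arg_cong)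
    also have "\<dots> = (\<Sum>j\<in>S. q (\<xi> j) * of_real (w (\<xi> j)) *
      gas_weight (S - {j}) (\<lambda>y. of_real (w y) * (u x - u y) * cnj (u (\<xi> j) - u y)) \<xi>)"
    proof (rule sum.cong[OF refl])
      fix j assume j: "j \<in> S"
      \<comment> \<open>A Lagrange denominator times its own squared modulus is its conjugate. This
        is how the second, conjugated argument of the kernel arises.\<close>
      have *: "(\<Prod>i\<in>S - {j}. (u x - u (\<xi> i)) / (u (\<xi> j) - u (\<xi> i))) *
              of_real (\<Prod>i\<in>S - {j}. (norm (u (\<xi> j) - u (\<xi> i)))\<^sup>2) =
            (\<Prod>i\<in>S - {j}. (u x - u (\<xi> i)) * cnj (u (\<xi> j) - u (\<xi> i)))"
        unfolding of_real_prod prod.distrib[symmetric]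
      proof (rule prod.cong[OF refl])
        fix i assume "i \<in> S - {j}"
        hence "u (\<xi> j) - u (\<xi> i) \<noteq> 0" using True j by (auto dest: inj_onD)
        thus "(u x - u (\<xi> i)) / (u (\<xi> j) - u (\<xi> i)) * of_real ((norm (u (\<xi> j) - u (\<xi> i)))\<^sup>2) =
            (u x - u (\<xi> i)) * cnj (u (\<xi> j) - u (\<xi> i))"
          unfolding complex_norm_square by (simp del: complex_cnj_diff)
      qed
      have "(\<Prod>i\<in>S. of_real (w (\<xi> i)) :: complex) =
          of_real (w (\<xi> j)) * (\<Prod>i\<in>S - {j}. of_real (w (\<xi> i)))"
        using fin j by (rule prod.remove)
      hence "q (\<xi> j) * (\<Prod>i\<in>S - {j}. (u x - u (\<xi> i)) / (u (\<xi> j) - u (\<xi> i)))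
           * gas_weight S (\<lambda>y. of_real (w y)) \<xi> =
         q (\<xi> j) * of_real (w (\<xi> j)) * (\<Prod>i\<in>S - {j}. of_real (w (\<xi> i))) *
          ((\<Prod>i\<in>S - {j}. (u x - u (\<xi> i)) / (u (\<xi> j) - u (\<xi> i))) *
              of_real (\<Prod>i\<in>S - {j}. (norm (u (\<xi> j) - u (\<xi> i)))\<^sup>2)) * of_real (vdm_sq (S - {j}) \<xi>)"
        unfolding gas_weight_def vdm_sq_remove[OF fin j] by (simp only: of_real_mult mult_ac)
      also have "\<dots> = q (\<xi> j) * of_real (w (\<xi> j)) *
        gas_weight (S - {j}) (\<lambda>y. of_real (w y) * (u x - u y) * cnj (u (\<xi> j) - u y)) \<xi>"
        unfolding * gas_weight_def by (simp only: prod.distrib mult_ac)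
      finally show "q (\<xi> j) * (\<Prod>i\<in>S - {j}. (u x - u (\<xi> i)) / (u (\<xi> j) - u (\<xi> i)))
           * gas_weight S (\<lambda>y. of_real (w y)) \<xi> = \<dots>" .
    qed
    finally show ?thesis .
  next
    case False
    then obtain i k where ik: "i \<in> S" "k \<in> S" "i \<noteq> k" "u (\<xi> i) = u (\<xi> k)"
      by (auto simp: inj_on_def)
    \<comment> \<open>If \<open>j\<close> is one of two coinciding nodes, the other one makes a
      conjugated factor vanish; otherwise both survive in \<open>S - {j}\<close> and the Vandermonde
      product vanishes.\<close>
    have "gas_weight (S - {j}) (\<lambda>y. of_real (w y) * (u x - u y) * cnj (u (\<xi> j) - u y)) \<xi> = 0"
      if "j \<in> S" for j
    proof (cases "j = i \<or> j = k")
      case True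
      then obtain l where "l \<in> S - {j}" "u (\<xi> l) = u (\<xi> j)" using ik by fastforce
      hence "(\<Prod>l\<in>S - {j}. of_real (w (\<xi> l)) * (u x - u (\<xi> l)) * cnj (u (\<xi> j) - u (\<xi> l))) = 0"
        using fin by (intro prod_zero bexI[of _ l]) auto
      thus ?thesis by (simp add: gas_weight_def del: complex_cnj_diff)
    next
      case False
      hence "vdm_sq (S - {j}) \<xi> = 0" using ik fin by (intro vdm_sq_eq_0[of _ i k]) auto
      thus ?thesis by (simp add: gas_weight_def)
    qed
    moreover have "gas_weight S (\<lambda>y. of_real (w y) :: complex) \<xi> = 0"
      using vdm_sq_eq_0[OF fin ik] by (simp add: gas_weight_def)
    ultimately show ?thesis by simp
  qed
qed

text \<open>Lagrange interpolation, cleared of denominators, is integrated over all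
  \<open>Suc n\<close> nodes. In the term of node \<open>j\<close> the remaining nodes integrate to
  a kernel with second argument the position of \<open>j\<close>, and by exchangeability the
  \<open>Suc n\<close> terms contribute equally.\<close>

lemma gas_kernel_reproducing:
  assumes "card S = Suc n" "finite I" "card I = n" "bounded_measurable M w"
    and q: "bounded_measurable M q" "interpolable n q"
  shows "of_real (gas_partition S w) * q x = of_nat (Suc n) * (\<integral>z. of_real (w z) * q z * gas_kernel I w x z \<partial>M)"
proof -
  have fin: "finite S" using assms(1) by (intro card_ge_0_finite) simp
  define T where "T = (\<lambda>j \<xi>. q (\<xi> j) * of_real (w (\<xi> j)) *
      gas_weight (S - {j}) (\<lambda>y. of_real (w y) * (u x - u y) * cnj (u (\<xi> j) - u y)) \<xi>)"
  have bmT: "bounded_measurable (prodM S) (T j)" if "j \<in> S" for j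
    unfolding T_def gas_weight_def vdm_sq_def using that
    by (intro bounded_measurable_intros bounded_measurable_coord q assms u_bounded_measurable
        bounded_measurable_coord[where f = w] bounded_measurable_coord[where f = u]) auto
  have T: "(\<integral>\<xi>. T j \<xi> \<partial>prodM S) = (\<integral>z. of_real (w z) * q z * gas_kernel I w x z \<partial>M)" if j: "j \<in> S" for j
  proof -
    have S: "S = insert j (S - {j})" using j by auto
    have "(\<integral>\<xi>. T j \<xi> \<partial>prodM S) = (\<integral>\<xi>. T j \<xi> \<partial>prodM (insert j (S - {j})))"
      using S by simp
    also have "\<dots> = (\<integral>z. \<integral>\<xi>. T j (\<xi>(j := z)) \<partial>prodM (S - {j}) \<partial>M)"
      using fin bmT[OF j] S by (intro integral_prodM_insert) auto
    also have "\<dots> = (\<integral>z. of_real (w z) * q z * gas_kernel (S - {j}) w x z \<partial>M)"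
      by (simp add: T_def gas_weight_fun_upd gas_kernel_def gas_partition_def mult_ac del: complex_cnj_diff)
    also have "\<dots> = (\<integral>z. of_real (w z) * q z * gas_kernel I w x z \<partial>M)"
    proof -
      have "gas_kernel (S - {j}) w x z = gas_kernel I w x z" for z
        unfolding gas_kernel_def using assms fin j
        by (intro gas_partition_card_cong bounded_measurable_intros u_bounded_measurable) auto
      thus ?thesis by simp
    qed
    finally show ?thesis .
  qed
  have "of_real (gas_partition S w) * q x = (\<integral>\<xi>. q x * gas_weight S (\<lambda>y. of_real (w y)) \<xi> \<partial>prodM S)"
    unfolding gas_partition_of_real[symmetric] by (simp add: gas_partition_def)
  also have "\<dots> = (\<integral>\<xi>. (\<Sum>j\<in>S. T j \<xi>) \<partial>prodM S)"
    unfolding T_def interpolable_gas_weight[OF assms(1) q(2)] ..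
  also have "\<dots> = (\<Sum>j\<in>S. \<integral>\<xi>. T j \<xi> \<partial>prodM S)"
    by (rule Bochner_Integration.integral_sum)
       (rule bounded_measurable_integrable[OF finite_measure_prodM bmT])
  finally show ?thesis using T assms(1) by simp
qed

section \<open>Negative correlation by comparison of kernels\<close>

text \<open>After multiplication by \<open>w x\<close> the two sides are one-particle intensities,
  with and without a particle pinned at \<open>a\<close>. They are diagonal values of the kernels of
  the polynomials of degree at most m + 1 and of those among them vanishing at \<open>u a\<close>.
  The latter are \<open>u - u a\<close> times the polynomials of degree at most m, on which the norm
  is that of the tilted weight. The kernel of a subspace is smaller on the diagonal.\<close>

lemma gas_partition_tilt_correlation:
  assumes S: "card S = Suc (Suc m)" and I: "card I = Suc m" and J: "finite J" "card J = m"
    and w: "bounded_measurable M w" "\<And>y. 0 \<le> w y"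
    and pos: "0 < gas_partition S w" "0 < gas_partition I (tilt w a)"
  shows "real (Suc m) * (norm (u a - u x))\<^sup>2 * gas_partition J (tilt (tilt w a) x) / gas_partition I (tilt w a)
       \<le> real (Suc (Suc m)) * gas_partition I (tilt w x) / gas_partition S w"
proof -
  have finI: "finite I" using I by (intro card_ge_0_finite) simp
  define A where "A z = gas_kernel I w z x" for z
  define C where "C z = gas_kernel J (tilt w a) z x" for z
  have hA: "gas_kernel I w x z = cnj (A z)" for z unfolding A_def by (rule gas_kernel_hermitian)
  have hC: "gas_kernel J (tilt w a) x z = cnj (C z)" for z unfolding C_def by (rule gas_kernel_hermitian)
  \<comment> \<open>With this constant \<open>B\<close> is, up to normalisation, the kernel of the
    subspace at \<open>x\<close>, and its value at \<open>x\<close> is real and nonnegative.\<close>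
  define c where "c = cnj (u x - u a)"
  define B where "B z = poly (smult c [:- u a, 1:]) (u z) * C z" for z
  note wa = bounded_measurable_tilt[OF w(1), of a]
  have bmA: "bounded_measurable M A" unfolding A_def by (rule bounded_measurable_gas_kernel[OF w(1)])
  have bmC: "bounded_measurable M C" unfolding C_def by (rule bounded_measurable_gas_kernel[OF wa])
  have B_eq: "B z = c * (u z - u a) * C z" for z by (simp add: B_def algebra_simps)
  have bmB: "bounded_measurable M B"
    unfolding B_eq by (intro bounded_measurable_intros bmC u_bounded_measurable)
  have iA: "interpolable (Suc m) A"
    using interpolable_poly_gas_kernel[of 1 I "Suc m" w x] I w by (simp add: A_def[abs_def])
  have iC: "interpolable m C"
    using interpolable_poly_gas_kernel[of 1 J m "tilt w a" x] J wa by (simp add: C_def[abs_def])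
  have iB: "interpolable (Suc m) B"
    unfolding B_def C_def
    using J wa degree_smult_le[of c "[:- u a, 1:]"] by (intro interpolable_poly_gas_kernel) auto
  note bm = bounded_measurable_integrable[OF finite_measure_axioms]
  define nA where "nA = (\<integral>z. w z * (norm (A z))\<^sup>2 \<partial>M)"
  define nB where "nB = (\<integral>z. w z * (norm (B z))\<^sup>2 \<partial>M)"
  define cr where "cr = (\<integral>z. w z * Re (B z * cnj (A z)) \<partial>M)"
  have bmRe: "bounded_measurable M (\<lambda>z. Re (B z * cnj (A z)))"
    by (intro bounded_measurable_bounded_linear[OF bounded_linear_Re] bounded_measurable_intros bmA bmB)
  have int: "integrable M (\<lambda>z. w z * (norm (A z))\<^sup>2)" "integrable M (\<lambda>z. w z * (norm (B z))\<^sup>2)"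
    "integrable M (\<lambda>z. w z * Re (B z * cnj (A z)))"
    by (intro bm bounded_measurable_intros w(1) bmA bmB bmRe)+
  have nsq: "y * cnj y = of_real ((norm y)\<^sup>2)" for y by (rule complex_norm_square[symmetric])
  define a' where "a' = gas_partition I (tilt w x)"
  define b' where "b' = (norm (u a - u x))\<^sup>2 * gas_partition J (tilt (tilt w a) x)"
  have Ax: "A x = of_real a'" unfolding A_def a'_def by (rule gas_kernel_diag)
  have Bx: "B x = of_real b'"
  proof -
    have "c * (u x - u a) = of_real ((norm (u a - u x))\<^sup>2)"
      unfolding c_def by (subst mult.commute) (simp only: nsq norm_minus_commute)
    thus ?thesis unfolding B_eq C_def gas_kernel_diag b'_def of_real_mult by (simp only:)
  qed
  have eqA: "gas_partition S w * a' = real (Suc (Suc m)) * nA"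
  proof -
    have "of_real (gas_partition S w) * A x = of_nat (Suc (Suc m)) * (\<integral>z. of_real (w z) * A z * cnj (A z) \<partial>M)"
      using gas_kernel_reproducing[OF S finI I w(1) bmA iA, of x] unfolding hA .
    also have "(\<integral>z. of_real (w z) * A z * cnj (A z) \<partial>M) = of_real nA"
      unfolding mult.assoc nsq of_real_mult[symmetric] nA_def by (rule integral_complex_of_real)
    finally have "complex_of_real (gas_partition S w * a') = of_real (real (Suc (Suc m)) * nA)"
      unfolding Ax by simp
    thus ?thesis unfolding of_real_eq_iff .
  qed
  \<comment> \<open>\<open>B\<close> also has degree at most m + 1, so the larger kernel reproduces
    it. As \<open>B x\<close> is real, taking real parts yields the cross term.\<close>
  have eqB: "gas_partition S w * b' = real (Suc (Suc m)) * cr"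
  proof -
    have "of_real (gas_partition S w) * B x = of_nat (Suc (Suc m)) * (\<integral>z. of_real (w z) * (B z * cnj (A z)) \<partial>M)"
      using gas_kernel_reproducing[OF S finI I w(1) bmB iB, of x] unfolding hA mult.assoc .
    hence "gas_partition S w * b' = real (Suc (Suc m)) * Re (\<integral>z. of_real (w z) * (B z * cnj (A z)) \<partial>M)"
      (is "_ = _ * Re ?r")
    proof -
      assume *: "of_real (gas_partition S w) * B x = of_nat (Suc (Suc m)) * ?r"
      have "gas_partition S w * b' = Re (of_real (gas_partition S w) * B x)"
        unfolding Bx of_real_mult[symmetric] by (rule Re_complex_of_real[symmetric])
      also have "\<dots> = real (Suc (Suc m)) * Re ?r"
        unfolding * times_complex.sel complex_Re_of_nat complex_Im_of_nat mult_zero_left diff_zero ..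
      finally show ?thesis .
    qed
    also have "Re (\<integral>z. of_real (w z) * (B z * cnj (A z)) \<partial>M) =
               (\<integral>z. Re (of_real (w z) * (B z * cnj (A z))) \<partial>M)"
      by (intro integral_Re[symmetric] bm bounded_measurable_intros w(1) bmA bmB)
    also have "\<dots> = cr" unfolding cr_def by (intro Bochner_Integration.integral_cong) simp_all
    finally show ?thesis .
  qed
  have eqC: "gas_partition I (tilt w a) * b' = real (Suc m) * nB"
  proof -
    define d where "d = (norm (u a - u x))\<^sup>2"
    have "of_real (gas_partition I (tilt w a)) * C x =
        of_nat (Suc m) * (\<integral>z. of_real (tilt w a z) * C z * cnj (C z) \<partial>M)"
      using gas_kernel_reproducing[OF I J wa bmC iC, of x] unfolding hC .
    also have "(\<integral>z. of_real (tilt w a z) * C z * cnj (C z) \<partial>M) =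
        of_real (\<integral>z. tilt w a z * (norm (C z))\<^sup>2 \<partial>M)"
      unfolding mult.assoc nsq of_real_mult[symmetric] by (rule integral_complex_of_real)
    finally have "complex_of_real (gas_partition I (tilt w a) * gas_partition J (tilt (tilt w a) x)) =
       of_real (real (Suc m) * (\<integral>z. tilt w a z * (norm (C z))\<^sup>2 \<partial>M))"
      unfolding C_def gas_kernel_diag by simp
    hence "gas_partition I (tilt w a) * gas_partition J (tilt (tilt w a) x) =
       real (Suc m) * (\<integral>z. tilt w a z * (norm (C z))\<^sup>2 \<partial>M)"
      unfolding of_real_eq_iff .
    hence "gas_partition I (tilt w a) * b' = real (Suc m) * (d * (\<integral>z. tilt w a z * (norm (C z))\<^sup>2 \<partial>M))"
      unfolding b'_def d_def[symmetric] by simp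
    \<comment> \<open>The squared distance in the tilted weight, together with \<open>d\<close>,
      which is the squared modulus of \<open>c\<close>, is absorbed into the squared modulus of
      \<open>B\<close>.\<close>
    also have "d * (\<integral>z. tilt w a z * (norm (C z))\<^sup>2 \<partial>M) = nB"
      unfolding nB_def integral_mult_right_zero[symmetric]
      by (intro Bochner_Integration.integral_cong)
         (simp_all add: B_eq c_def d_def tilt_def norm_mult power_mult_distrib
            norm_minus_commute mult_ac del: complex_cnj_diff)
    finally show ?thesis .
  qed
  define \<alpha> where "\<alpha> = real (Suc (Suc m)) / gas_partition S w"
  define \<beta> where "\<beta> = real (Suc m) / gas_partition I (tilt w a)"
  \<comment> \<open>\<open>\<alpha>\<close> and \<open>\<beta>\<close> normalise \<open>A\<close>
    and \<open>B\<close> to reproducing kernels at \<open>x\<close>. In the squared norm of their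
    difference all three terms reduce to values at \<open>x\<close>, leaving
    \<open>\<alpha> * a' - \<beta> * b'\<close>.\<close>
  have "0 \<le> (\<integral>z. w z * (norm (of_real \<alpha> * A z - of_real \<beta> * B z))\<^sup>2 \<partial>M)"
    by (intro Bochner_Integration.integral_nonneg mult_nonneg_nonneg w) auto
  also have "\<dots> = (\<integral>z. \<alpha>\<^sup>2 * (w z * (norm (A z))\<^sup>2) - 2 * \<alpha> * \<beta> * (w z * Re (B z * cnj (A z)))
       + \<beta>\<^sup>2 * (w z * (norm (B z))\<^sup>2) \<partial>M)"
    unfolding cmod_power2
    by (intro Bochner_Integration.integral_cong refl) (simp add: algebra_simps power2_eq_square)
  also have "\<dots> = \<alpha>\<^sup>2 * nA - 2 * \<alpha> * \<beta> * cr + \<beta>\<^sup>2 * nB"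
    using int by (simp add: nA_def nB_def cr_def)
  also have "\<dots> = \<alpha> * (\<alpha> * nA) - 2 * \<beta> * (\<alpha> * cr) + \<beta> * (\<beta> * nB)"
    by (simp add: power2_eq_square)
  also have "\<alpha> * nA = a'" using eqA pos by (simp add: \<alpha>_def field_simps)
  also have "\<alpha> * cr = b'" using eqB pos by (simp add: \<alpha>_def field_simps)
  also have "\<beta> * nB = b'" using eqC pos by (simp add: \<beta>_def field_simps)
  finally have "\<beta> * b' \<le> \<alpha> * a'" by simp
  thus ?thesis by (simp add: \<alpha>_def \<beta>_def a'_def b'_def)
qed

end

subsection \<open>Exponential moments\<close>

text \<open>The uncentred form with the mean on the right-hand side fits the induction on the number
  of particles, where conditional means are combined into the full mean.\<close>

lemma (in interval_bounded_random_variable) Hoeffdings_lemma_integral: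
  assumes "l > 0"
  shows "integrable M (\<lambda>x. exp (l * f x))"
    and "(\<integral>x. exp (l * f x) \<partial>M) \<le> exp (l * (\<integral>x. f x \<partial>M) + l\<^sup>2 * (b - a)\<^sup>2 / 8)"
proof -
  have AEb: "AE x in M. norm (exp (l * f x)) \<le> exp (l * b)"
    using AE_in_interval by eventually_elim (use assms in auto)
  show int: "integrable M (\<lambda>x. exp (l * f x))"
    by (rule integrable_const_bound[OF AEb]) measurable
  have "ennreal (\<integral>x. exp (l * (f x - expectation f)) \<partial>M) =
        (\<integral>\<^sup>+x. ennreal (exp (l * (f x - expectation f))) \<partial>M)"
    using int by (intro nn_integral_eq_integral[symmetric])
      (simp_all add: right_diff_distrib exp_diff)
  also have "\<dots> \<le> ennreal (exp (l\<^sup>2 * (b - a)\<^sup>2 / 8))"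
    by (rule Hoeffdings_lemma_nn_integral[OF assms])
  finally have "(\<integral>x. exp (l * (f x - expectation f)) \<partial>M) \<le> exp (l\<^sup>2 * (b - a)\<^sup>2 / 8)"
    by (simp add: ennreal_le_iff)
  also have "(\<integral>x. exp (l * (f x - expectation f)) \<partial>M) = (\<integral>x. exp (l * f x) \<partial>M) / exp (l * expectation f)"
    by (simp add: right_diff_distrib exp_diff)
  finally show "(\<integral>x. exp (l * f x) \<partial>M) \<le> exp (l * (\<integral>x. f x \<partial>M) + l\<^sup>2 * (b - a)\<^sup>2 / 8)"
    by (simp add: exp_add divide_le_eq mult.commute)
qed

context vandermonde_gas
begin

definition gas_mean :: "nat set \<Rightarrow> ('a \<Rightarrow> real) \<Rightarrow> (nat \<Rightarrow> 'a \<Rightarrow> real) \<Rightarrow> real" where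
  "gas_mean I w g = (\<integral>\<xi>. gas_weight I w \<xi> * (\<Sum>j\<in>I. g j (\<xi> j)) \<partial>prodM I) / gas_partition I w"

lemma AE_gas_weight_eq_0:
  assumes "bounded_measurable M w" "\<And>y. (0::real) \<le> w y" "gas_partition I w = 0"
  shows "AE \<xi> in prodM I. gas_weight I w \<xi> = 0"
  using assms(3) unfolding gas_partition_def
  by (subst (asm) integral_nonneg_eq_0_iff_AE)
     (auto intro!: bounded_measurable_integrable[OF finite_measure_prodM]
       bounded_measurable_gas_weight gas_weight_nonneg assms)

text \<open>If the partition function is 0, the nonnegative weight vanishes almost everywhere, so
  the identity survives the default value of division by 0. Degenerate pinned weights can thus stay
  inside integrals over the pinned position.\<close>

lemma gas_partition_mult_gas_mean:
  assumes "bounded_measurable M w" "\<And>y. 0 \<le> w y"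
  shows "gas_partition I w * gas_mean I w g = (\<integral>\<xi>. gas_weight I w \<xi> * (\<Sum>j\<in>I. g j (\<xi> j)) \<partial>prodM I)"
proof (cases "gas_partition I w = 0")
  case True
  have "(\<integral>\<xi>. gas_weight I w \<xi> * (\<Sum>j\<in>I. g j (\<xi> j)) \<partial>prodM I) = 0"
    using AE_gas_weight_eq_0[OF assms True] by (intro integral_eq_zero_AE) auto
  thus ?thesis using True by simp
qed (simp add: gas_mean_def)

lemma bounded_measurable_linear_statistic:
  fixes g :: "nat \<Rightarrow> 'a \<Rightarrow> real"
  assumes "\<And>j. j \<in> I \<Longrightarrow> bounded_measurable M (g j)"
  shows "bounded_measurable (prodM I) (\<lambda>\<xi>. \<Sum>j\<in>I. g j (\<xi> j))"
  by (intro bounded_measurable_sum bounded_measurable_coord assms)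

text \<open>The point is that \<open>C\<close> does not depend on \<open>a\<close>. It is formed
  like the conditional mean, but with the intensity \<open>r\<close> of the full gas in place of the
  pinned intensities \<open>e k\<close>. Each difference \<open>r - e k\<close> is nonnegative of
  mass one, so it integrates \<open>g k\<close> to a number in [0, c], and the average over
  \<open>k\<close> stays there.\<close>

lemma gas_mean_tilt_bounds:
  assumes I: "finite I" "i \<notin> I" and w: "bounded_measurable M w" "\<And>y. 0 \<le> w y"
    and pos: "0 < gas_partition (insert i I) w"
    and g: "\<And>j. j \<in> I \<Longrightarrow> bounded_measurable M (g j)" "\<And>j y. j \<in> I \<Longrightarrow> g j y \<in> {0..c}" and c: "0 \<le> c"
  shows "\<exists>C. \<forall>a. 0 < gas_partition I (tilt w a) \<longrightarrow> gas_mean I (tilt w a) g \<in> {C - c..C}"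
proof (cases "I = {}")
  case True
  thus ?thesis using c by (intro exI[of _ 0]) (simp add: gas_mean_def)
next
  case False
  then obtain m where m: "card I = Suc m" using I by (metis card_eq_0_iff not0_implies_Suc)
  \<comment> \<open>The intensity of the full gas, of total mass m + 2; the pinned intensities
    \<open>e k\<close> below have mass m + 1.\<close>
  define r where "r x = real (Suc (Suc m)) * (w x * gas_partition I (tilt w x)) / gas_partition (insert i I) w" for x
  define C where "C = (\<Sum>k\<in>I. \<integral>x. g k x * r x \<partial>M) / real (Suc m)"
  note bm = bounded_measurable_integrable[OF finite_measure_axioms]
  have bmr: "bounded_measurable M r"
    unfolding r_def divide_inverse
    by (intro bounded_measurable_intros w bounded_measurable_gas_partition_tilt)
  have int_r: "(\<integral>x. r x \<partial>M) = real (Suc (Suc m))"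
    using pos I w unfolding r_def by (simp add: gas_partition_insert)
  have "gas_mean I (tilt w a) g \<in> {C - c..C}" if a: "0 < gas_partition I (tilt w a)" for a
  proof -
    define e where "e k x = real (Suc m) * (tilt w a x * gas_partition (I - {k}) (tilt (tilt w a) x))
      / gas_partition I (tilt w a)" for k x
    note wa = bounded_measurable_tilt[OF w(1), of a]
    have bme: "bounded_measurable M (e k)" for k
      unfolding e_def divide_inverse
      by (intro bounded_measurable_intros wa bounded_measurable_gas_partition_tilt)
    have int_e: "(\<integral>x. e k x \<partial>M) = real (Suc m)" if "k \<in> I" for k
      using gas_partition_insert[of "I - {k}" k "tilt w a"] that I wa a
      unfolding e_def by (simp add: insert_absorb)
    have le: "e k x \<le> r x" if "k \<in> I" for k x
    proof -
      have "real (Suc m) * (norm (u a - u x))\<^sup>2 * gas_partition (I - {k}) (tilt (tilt w a) x) / gas_partition I (tilt w a)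
         \<le> real (Suc (Suc m)) * gas_partition I (tilt w x) / gas_partition (insert i I) w"
        using m I that w pos a by (intro gas_partition_tilt_correlation) auto
      from mult_left_mono[OF this w(2)[of x]] show ?thesis
        by (simp add: e_def r_def tilt_def mult_ac)
    qed
    have mean: "gas_mean I (tilt w a) g = (\<Sum>k\<in>I. \<integral>x. g k x * e k x \<partial>M) / real (Suc m)"
    proof -
      have "(\<integral>\<xi>. gas_weight I (tilt w a) \<xi> * (\<Sum>j\<in>I. g j (\<xi> j)) \<partial>prodM I)
          = (\<integral>\<xi>. (\<Sum>j\<in>I. g j (\<xi> j) * gas_weight I (tilt w a) \<xi>) \<partial>prodM I)"
        by (simp add: sum_distrib_right mult.commute)
      also have "\<dots> = (\<Sum>j\<in>I. \<integral>\<xi>. g j (\<xi> j) * gas_weight I (tilt w a) \<xi> \<partial>prodM I)"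
        by (intro Bochner_Integration.integral_sum bounded_measurable_integrable[OF finite_measure_prodM]
            bounded_measurable_mult bounded_measurable_coord bounded_measurable_gas_weight wa g)
      also have "\<dots> = (\<Sum>j\<in>I. \<integral>x. g j x * tilt w a x * gas_partition (I - {j}) (tilt (tilt w a) x) \<partial>M)"
        by (intro sum.cong refl integral_coord_gas_weight I wa g)
      also have "\<dots> = (\<Sum>j\<in>I. gas_partition I (tilt w a) / real (Suc m) * (\<integral>x. g j x * e j x \<partial>M))"
        using a unfolding e_def integral_mult_right_zero[symmetric]
        by (intro sum.cong Bochner_Integration.integral_cong refl) (simp add: mult_ac)
      also have "\<dots> = gas_partition I (tilt w a) / real (Suc m) * (\<Sum>j\<in>I. \<integral>x. g j x * e j x \<partial>M)"
        by (rule sum_distrib_left[symmetric])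
      finally show ?thesis using a by (simp add: gas_mean_def)
    qed
    have diff: "C - gas_mean I (tilt w a) g = (\<Sum>k\<in>I. \<integral>x. g k x * (r x - e k x) \<partial>M) / real (Suc m)"
    proof -
      have "(\<integral>x. g k x * (r x - e k x) \<partial>M) = (\<integral>x. g k x * r x \<partial>M) - (\<integral>x. g k x * e k x \<partial>M)"
        if "k \<in> I" for k
        unfolding right_diff_distrib
        by (intro Bochner_Integration.integral_diff bm bounded_measurable_mult g bmr bme that)
      thus ?thesis unfolding C_def mean by (simp add: sum_subtractf diff_divide_distrib)
    qed
    have "(\<integral>x. g k x * (r x - e k x) \<partial>M) \<le> c" if k: "k \<in> I" for k
    proof -
      have "(\<integral>x. g k x * (r x - e k x) \<partial>M) \<le> (\<integral>x. c * (r x - e k x) \<partial>M)"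
        using g(2)[OF k] le[OF k]
        by (intro integral_mono bm bounded_measurable_intros g bmr bme k mult_right_mono) auto
      also have "\<dots> = c * ((\<integral>x. r x \<partial>M) - (\<integral>x. e k x \<partial>M))"
        using bm[OF bmr] bm[OF bme] by simp
      also have "\<dots> = c" by (simp add: int_r int_e k)
      finally show ?thesis .
    qed
    hence "(\<Sum>k\<in>I. \<integral>x. g k x * (r x - e k x) \<partial>M) \<le> real (Suc m) * c"
      using sum_bounded_above[of I "\<lambda>k. \<integral>x. g k x * (r x - e k x) \<partial>M" c] m by simp
    moreover have "0 \<le> (\<Sum>k\<in>I. \<integral>x. g k x * (r x - e k x) \<partial>M)"
      using g(2) le by (intro sum_nonneg Bochner_Integration.integral_nonneg mult_nonneg_nonneg) auto
    ultimately have "0 \<le> C - gas_mean I (tilt w a) g" "C - gas_mean I (tilt w a) g \<le> c"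
      unfolding diff by (simp_all add: divide_le_eq mult.commute)
    thus ?thesis by simp
  qed
  thus ?thesis by blast
qed

text \<open>The tower property, unnormalised: the full mean is the average over the revealed
  position of its own summand plus the conditional mean of the rest.\<close>

lemma integral_insert_linear:
  assumes I: "finite I" "i \<notin> I" and w: "bounded_measurable M w" "\<And>y. 0 \<le> w y"
    and g: "\<And>j. j \<in> insert i I \<Longrightarrow> bounded_measurable M (g j)"
  shows "(\<integral>\<xi>. gas_weight (insert i I) w \<xi> * (\<Sum>j\<in>insert i I. g j (\<xi> j)) \<partial>prodM (insert i I)) =
    (\<integral>a. w a * gas_partition I (tilt w a) * (g i a + gas_mean I (tilt w a) g) \<partial>M)"
proof -
  have upd: "(\<Sum>j\<in>insert i I. g j ((\<xi>(i := a)) j)) = g i a + (\<Sum>j\<in>I. g j (\<xi> j))" for \<xi> a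
  proof -
    have "(\<Sum>j\<in>I. g j ((\<xi>(i := a)) j)) = (\<Sum>j\<in>I. g j (\<xi> j))"
      using I by (intro sum.cong) auto
    thus ?thesis using I by simp
  qed
  have "(\<integral>\<xi>. gas_weight (insert i I) w \<xi> * (\<Sum>j\<in>insert i I. g j (\<xi> j)) \<partial>prodM (insert i I)) =
     (\<integral>a. (\<integral>\<xi>. w a * (gas_weight I (tilt w a) \<xi> * g i a +
        gas_weight I (tilt w a) \<xi> * (\<Sum>j\<in>I. g j (\<xi> j))) \<partial>prodM I) \<partial>M)"
    by (subst integral_prodM_insert[OF I bounded_measurable_mult[OF bounded_measurable_gas_weight[OF w(1)]
        bounded_measurable_linear_statistic[OF g]]])
       (simp_all only: gas_weight_insert[OF I] upd distrib_left mult.assoc)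
  also have "\<dots> = (\<integral>a. w a * gas_partition I (tilt w a) * (g i a + gas_mean I (tilt w a) g) \<partial>M)"
  proof (intro Bochner_Integration.integral_cong refl)
    fix a
    note wa = bounded_measurable_tilt[OF w(1), of a]
    have bm1: "integrable (prodM I) (gas_weight I (tilt w a))"
      by (intro bounded_measurable_integrable[OF finite_measure_prodM] bounded_measurable_gas_weight wa)
    have bm2: "integrable (prodM I) (\<lambda>\<xi>. gas_weight I (tilt w a) \<xi> * (\<Sum>j\<in>I. g j (\<xi> j)))"
      by (intro bounded_measurable_integrable[OF finite_measure_prodM] bounded_measurable_mult
          bounded_measurable_gas_weight wa bounded_measurable_linear_statistic g) auto
    have "(\<integral>\<xi>. w a * (gas_weight I (tilt w a) \<xi> * g i a +
        gas_weight I (tilt w a) \<xi> * (\<Sum>j\<in>I. g j (\<xi> j))) \<partial>prodM I) =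
       w a * (gas_partition I (tilt w a) * g i a + gas_partition I (tilt w a) * gas_mean I (tilt w a) g)"
      using bm1 bm2 unfolding gas_partition_mult_gas_mean[OF wa tilt_nonneg[OF w(2)]]
      by (simp add: gas_partition_def)
    thus "(\<integral>\<xi>. w a * (gas_weight I (tilt w a) \<xi> * g i a +
        gas_weight I (tilt w a) \<xi> * (\<Sum>j\<in>I. g j (\<xi> j))) \<partial>prodM I) =
       w a * gas_partition I (tilt w a) * (g i a + gas_mean I (tilt w a) g)"
      by (simp add: algebra_simps)
  qed
  finally show ?thesis .
qed

lemma borel_measurable_gas_mean_tilt:
  assumes "bounded_measurable M w" "\<And>j. j \<in> I \<Longrightarrow> bounded_measurable M (g j)"
  shows "(\<lambda>a. gas_mean I (tilt w a) g) \<in> borel_measurable M"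
  unfolding gas_mean_def
  by (intro borel_measurable_divide bounded_measurable_borel bounded_measurable_gas_partition_tilt assms
      bounded_measurable_gas_partition_param[OF bounded_measurable_tilt_pair]
      bounded_measurable_linear_statistic)

text \<open>Given the revealed particle at \<open>a\<close>, the induction hypothesis for the tilted
  weight bounds the moment of the rest through its conditional mean. What remains is the exponential
  moment of the single variable \<open>G\<close>, to which Hoeffding's lemma applies because its
  range has length at most 2c.\<close>

lemma gas_exponential_moment:
  assumes "finite I" "bounded_measurable M w" "\<And>y. 0 \<le> w y"
    and "\<And>j. j \<in> I \<Longrightarrow> bounded_measurable M (g j)" "\<And>j y. j \<in> I \<Longrightarrow> g j y \<in> {0..c}"
    and l: "0 < l" and c: "0 \<le> c"
  shows "(\<integral>\<xi>. gas_weight I w \<xi> * exp (l * (\<Sum>j\<in>I. g j (\<xi> j))) \<partial>prodM I) \<le>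
         gas_partition I w * exp (l * gas_mean I w g + real (card I) * (l\<^sup>2 * c\<^sup>2 / 2))"
  using assms(1-5)
proof (induction I arbitrary: w rule: finite_induct)
  case empty
  show ?case by (simp add: gas_partition_def[symmetric] gas_mean_def)
next
  case (insert i I)
  note w = insert.prems(1,2) and g = insert.prems(3,4) and I = insert.hyps(1,2)
  let ?S = "insert i I"
  show ?case
  proof (cases "gas_partition ?S w = 0")
    case True
    have "(\<integral>\<xi>. gas_weight ?S w \<xi> * exp (l * (\<Sum>j\<in>?S. g j (\<xi> j))) \<partial>prodM ?S) = 0"
      using AE_gas_weight_eq_0[OF w True] by (intro integral_eq_zero_AE) auto
    thus ?thesis using True by simp
  next
    case False
    hence pos: "0 < gas_partition ?S w" using gas_partition_nonneg[of w ?S] w by (simp add: order_less_le)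
    obtain C where C: "\<And>a. 0 < gas_partition I (tilt w a) \<Longrightarrow> gas_mean I (tilt w a) g \<in> {C - c..C}"
      using gas_mean_tilt_bounds[OF I w pos, of g c] g c by auto
    \<comment> \<open>The density of the revealed particle; \<open>G\<close> is the conditional mean
      of the whole statistic given its position.\<close>
    define p where "p a = w a * gas_partition I (tilt w a) / gas_partition ?S w" for a
    define G where "G a = g i a + gas_mean I (tilt w a) g" for a
    have p_nonneg: "0 \<le> p a" for a
      using pos w(2) by (simp add: p_def gas_partition_nonneg tilt_nonneg)
    have bmp: "bounded_measurable M p"
      unfolding p_def divide_inverse
      by (intro bounded_measurable_intros w bounded_measurable_gas_partition_tilt)
    have [measurable]: "p \<in> borel_measurable M" using bmp by (rule bounded_measurable_borel)
    have [measurable]: "G \<in> borel_measurable M"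
      unfolding G_def using g w
      by (intro borel_measurable_add borel_measurable_gas_mean_tilt bounded_measurable_borel) auto
    have int_p: "(\<integral>a. p a \<partial>M) = 1" using pos I w unfolding p_def by (simp add: gas_partition_insert)
    define D where "D = density M (\<lambda>a. ennreal (p a))"
    have "emeasure D (space D) = 1"
    proof -
      have "emeasure D (space D) = (\<integral>\<^sup>+a. ennreal (p a) \<partial>M)"
        unfolding D_def by (simp add: emeasure_density cong: nn_integral_cong)
      also have "\<dots> = ennreal (\<integral>a. p a \<partial>M)"
        using p_nonneg by (intro nn_integral_eq_integral
            bounded_measurable_integrable[OF finite_measure_axioms] bmp) auto
      finally show ?thesis by (simp add: int_p)
    qed
    then interpret D: prob_space D by (rule prob_spaceI)
    interpret X: interval_bounded_random_variable D G "C - c" "C + c"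
    proof
      show "G \<in> borel_measurable D" unfolding D_def by simp
      \<comment> \<open>The interval [C - c, C] for the conditional mean is known only where the
        pinned partition function is positive; elsewhere \<open>p\<close> is 0, so those positions
        form a null set of \<open>D\<close>.\<close>
      have "G a \<in> {C - c..C + c}" if "0 < p a" for a
      proof -
        have "gas_partition I (tilt w a) \<noteq> 0" using that by (auto simp: p_def)
        hence "0 < gas_partition I (tilt w a)"
          using gas_partition_nonneg[of "tilt w a" I] tilt_nonneg[of w a] w(2) by (simp add: order_less_le)
        thus ?thesis using C[of a] g(2)[of i a] by (auto simp: G_def)
      qed
      thus "AE a in D. G a \<in> {C - c..C + c}" unfolding D_def by (subst AE_density) auto
    qed
    have EG: "(\<integral>a. G a \<partial>D) = gas_mean ?S w g"
    proof -
      have "(\<integral>a. G a \<partial>D) = (\<integral>a. p a * G a \<partial>M)"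
        unfolding D_def using p_nonneg by (subst integral_density) auto
      also have "\<dots> = (\<integral>a. w a * gas_partition I (tilt w a) * G a \<partial>M) / gas_partition ?S w"
        by (simp add: p_def)
      also have "\<dots> = gas_mean ?S w g"
        unfolding G_def gas_mean_def[of ?S]
        by (subst integral_insert_linear[OF I w g(1)]) simp_all
      finally show ?thesis .
    qed
    have intD: "integrable M (\<lambda>a. p a * exp (l * G a))"
      using X.Hoeffdings_lemma_integral(1)[OF l] p_nonneg unfolding D_def
      by (subst (asm) integrable_density) auto
    have hoeff: "(\<integral>a. p a * exp (l * G a) \<partial>M) \<le> exp (l * gas_mean ?S w g + l\<^sup>2 * c\<^sup>2 / 2)"
    proof -
      have "(\<integral>a. p a * exp (l * G a) \<partial>M) = (\<integral>a. exp (l * G a) \<partial>D)"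
        unfolding D_def using p_nonneg by (subst integral_density) auto
      also have "\<dots> \<le> exp (l * gas_mean ?S w g + l\<^sup>2 * ((C + c) - (C - c))\<^sup>2 / 8)"
        using X.Hoeffdings_lemma_integral(2)[OF l] by (simp only: EG)
      finally show ?thesis by (simp add: power2_eq_square mult_ac)
    qed
    let ?E = "\<lambda>\<xi>. exp (l * (\<Sum>j\<in>I. g j (\<xi> j)))"
    have upd: "exp (l * (\<Sum>j\<in>?S. g j ((\<xi>(i := a)) j))) = exp (l * g i a) * ?E \<xi>" for \<xi> a
    proof -
      have "(\<Sum>j\<in>I. g j ((\<xi>(i := a)) j)) = (\<Sum>j\<in>I. g j (\<xi> j))"
        using I by (intro sum.cong) auto
      thus ?thesis using I by (simp add: exp_add[symmetric] distrib_left)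
    qed
    have bmE: "bounded_measurable (prodM ?S) (\<lambda>\<xi>. gas_weight ?S w \<xi> * exp (l * (\<Sum>j\<in>?S. g j (\<xi> j))))"
      by (intro bounded_measurable_intros bounded_measurable_gas_weight w
          bounded_measurable_linear_statistic g)
    have bmL: "bounded_measurable M (\<lambda>a. \<integral>\<xi>. gas_weight I (tilt w a) \<xi> * ?E \<xi> \<partial>prodM I)"
      using g by (intro bounded_measurable_gas_partition_param bounded_measurable_tilt_pair w
          bounded_measurable_intros bounded_measurable_linear_statistic) auto
    have "(\<integral>\<xi>. gas_weight ?S w \<xi> * exp (l * (\<Sum>j\<in>?S. g j (\<xi> j))) \<partial>prodM ?S) =
       (\<integral>a. w a * exp (l * g i a) * (\<integral>\<xi>. gas_weight I (tilt w a) \<xi> * ?E \<xi> \<partial>prodM I) \<partial>M)"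
      unfolding integral_prodM_insert[OF I bmE] gas_weight_insert[OF I] upd
      by (subst integral_mult_right_zero[symmetric]) (simp only: mult_ac)
    also have "\<dots> \<le> (\<integral>a. (gas_partition ?S w * exp (real (card I) * (l\<^sup>2 * c\<^sup>2 / 2))) * (p a * exp (l * G a)) \<partial>M)"
    proof (intro integral_mono)
      show "integrable M (\<lambda>a. w a * exp (l * g i a) *
              (\<integral>\<xi>. gas_weight I (tilt w a) \<xi> * ?E \<xi> \<partial>prodM I))"
        using g by (intro bounded_measurable_integrable[OF finite_measure_axioms]
            bounded_measurable_intros bmL w) auto
      show "integrable M (\<lambda>a. (gas_partition ?S w * exp (real (card I) * (l\<^sup>2 * c\<^sup>2 / 2))) * (p a * exp (l * G a)))"
        using intD by simp
      fix a
      have "(\<integral>\<xi>. gas_weight I (tilt w a) \<xi> * ?E \<xi> \<partial>prodM I) \<le>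
        gas_partition I (tilt w a) * exp (l * gas_mean I (tilt w a) g + real (card I) * (l\<^sup>2 * c\<^sup>2 / 2))"
        using g by (intro insert.IH bounded_measurable_tilt w tilt_nonneg) auto
      from mult_left_mono[OF this, of "w a * exp (l * g i a)"]
      show "w a * exp (l * g i a) * (\<integral>\<xi>. gas_weight I (tilt w a) \<xi> * ?E \<xi> \<partial>prodM I) \<le>
        (gas_partition ?S w * exp (real (card I) * (l\<^sup>2 * c\<^sup>2 / 2))) * (p a * exp (l * G a))"
        using w(2)[of a] pos by (simp add: p_def G_def exp_add distrib_left mult_ac)
    qed
    also have "\<dots> = (gas_partition ?S w * exp (real (card I) * (l\<^sup>2 * c\<^sup>2 / 2))) * (\<integral>a. p a * exp (l * G a) \<partial>M)"
      by (rule integral_mult_right_zero)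
    also have "\<dots> \<le> (gas_partition ?S w * exp (real (card I) * (l\<^sup>2 * c\<^sup>2 / 2))) *
        exp (l * gas_mean ?S w g + l\<^sup>2 * c\<^sup>2 / 2)"
      using pos by (intro mult_left_mono hoeff) auto
    also have "\<dots> = gas_partition ?S w * exp (l * gas_mean ?S w g + real (card ?S) * (l\<^sup>2 * c\<^sup>2 / 2))"
      using I by (simp add: exp_add[symmetric] algebra_simps)
    finally show ?thesis .
  qed
qed

end

subsection \<open>Concentration\<close>

context vandermonde_gas
begin

definition gas :: "nat set \<Rightarrow> ('a \<Rightarrow> real) \<Rightarrow> (nat \<Rightarrow> 'a) measure" where
  "gas I w = density (prodM I) (\<lambda>\<xi>. ennreal (gas_weight I w \<xi> / gas_partition I w))"

lemma space_gas [simp]: "space (gas I w) = space (prodM I)"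
  and sets_gas [measurable_cong, simp]: "sets (gas I w) = sets (prodM I)"
  by (simp_all add: gas_def)

lemma integral_gas:
  assumes "bounded_measurable M w" "\<And>y. 0 \<le> w y" "f \<in> borel_measurable (prodM I)"
  shows "(\<integral>\<xi>. f \<xi> \<partial>gas I w) = (\<integral>\<xi>. gas_weight I w \<xi> * f \<xi> \<partial>prodM I) / gas_partition I w"
proof -
  have [measurable]: "gas_weight I w \<in> borel_measurable (prodM I)"
    by (intro bounded_measurable_borel bounded_measurable_gas_weight assms)
  show ?thesis
    unfolding gas_def using assms
    by (subst integral_density) (auto simp: gas_weight_nonneg gas_partition_nonneg)
qed

lemma prob_space_gas:
  assumes "bounded_measurable M w" "\<And>y. 0 \<le> w y" "0 < gas_partition I w"
  shows "prob_space (gas I w)"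
proof (rule prob_spaceI)
  have bm: "bounded_measurable (prodM I) (gas_weight I w)"
    by (intro bounded_measurable_gas_weight assms)
  hence [measurable]: "gas_weight I w \<in> borel_measurable (prodM I)"
    by (rule bounded_measurable_borel)
  have "emeasure (gas I w) (space (gas I w)) =
      (\<integral>\<^sup>+\<xi>. ennreal (gas_weight I w \<xi> / gas_partition I w) \<partial>prodM I)"
    by (simp add: gas_def emeasure_density cong: nn_integral_cong)
  also have "\<dots> = ennreal (\<integral>\<xi>. gas_weight I w \<xi> / gas_partition I w \<partial>prodM I)"
    using assms by (intro nn_integral_eq_integral integrable_divide
        bounded_measurable_integrable[OF finite_measure_prodM] bm)
      (auto simp: gas_weight_nonneg)
  also have "\<dots> = 1" using assms(3) by (simp add: gas_partition_def)
  finally show "emeasure (gas I w) (space (gas I w)) = 1" .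
qed

lemma gas_upper_tail:
  assumes "finite I" "I \<noteq> {}" "bounded_measurable M w" "\<And>y. 0 \<le> w y" "0 < gas_partition I w"
    and g: "\<And>j. j \<in> I \<Longrightarrow> bounded_measurable M (g j)" "\<And>j y. j \<in> I \<Longrightarrow> g j y \<in> {0..c}"
    and c: "0 < c" and t: "0 < t"
  shows "measure (gas I w) {\<xi> \<in> space (gas I w). (\<Sum>j\<in>I. g j (\<xi> j)) \<ge> gas_mean I w g + t}
       \<le> exp (- (t\<^sup>2 / (2 * real (card I) * c\<^sup>2)))"
proof -
  interpret G: prob_space "gas I w" by (rule prob_space_gas) fact+
  define n where "n = real (card I)"
  have n: "0 < n" using assms(1,2) by (simp add: n_def card_gt_0_iff)
  \<comment> \<open>The minimiser of n l^2 c^2 / 2 - l t, with minimum -t^2 / (2 n c^2).\<close>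
  define l where "l = t / (n * c\<^sup>2)"
  have l: "0 < l" using n c t by (simp add: l_def)
  let ?f = "\<lambda>\<xi>. exp (l * (\<Sum>j\<in>I. g j (\<xi> j)))"
  have bm: "bounded_measurable (prodM I) ?f"
    by (intro bounded_measurable_intros bounded_measurable_linear_statistic g)
  have int: "integrable (gas I w) ?f"
  proof (rule bounded_measurable_integrable[OF G.finite_measure_axioms])
    show "bounded_measurable (gas I w) ?f"
      using bm unfolding bounded_measurable_def by (simp cong: measurable_cong_sets)
  qed
  let ?a = "exp (l * (gas_mean I w g + t))"
  have "{\<xi> \<in> space (gas I w). (\<Sum>j\<in>I. g j (\<xi> j)) \<ge> gas_mean I w g + t} =
        {\<xi> \<in> space (gas I w). ?f \<xi> \<ge> ?a}"
    using l by auto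
  hence "measure (gas I w) {\<xi> \<in> space (gas I w). (\<Sum>j\<in>I. g j (\<xi> j)) \<ge> gas_mean I w g + t}
     \<le> (\<integral>\<xi>. ?f \<xi> \<partial>gas I w) / ?a"
    using integral_Markov_inequality_measure[OF int sets.empty_sets, of ?a] by simp
  also have "(\<integral>\<xi>. ?f \<xi> \<partial>gas I w) = (\<integral>\<xi>. gas_weight I w \<xi> * ?f \<xi> \<partial>prodM I) / gas_partition I w"
    by (intro integral_gas bounded_measurable_borel[OF bm]) fact+
  also have "\<dots> \<le> exp (l * gas_mean I w g + n * (l\<^sup>2 * c\<^sup>2 / 2))"
    using gas_exponential_moment[OF assms(1,3,4) g l less_imp_le[OF c]] assms(5)
    by (simp add: n_def divide_le_eq mult.commute)
  finally have "measure (gas I w) {\<xi> \<in> space (gas I w). (\<Sum>j\<in>I. g j (\<xi> j)) \<ge> gas_mean I w g + t}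
     \<le> exp (l * gas_mean I w g + n * (l\<^sup>2 * c\<^sup>2 / 2)) / ?a"
    by (simp add: divide_right_mono)
  also have "\<dots> = exp (n * (l\<^sup>2 * c\<^sup>2 / 2) - l * t)"
    by (simp add: exp_diff[symmetric] distrib_left)
  also have "n * (l\<^sup>2 * c\<^sup>2 / 2) - l * t = - (t\<^sup>2 / (2 * n * c\<^sup>2))"
    using n c by (simp add: l_def field_simps power2_eq_square)
  finally show ?thesis by (simp add: n_def)
qed

lemma gas_concentration:
  assumes "finite I" "I \<noteq> {}" "bounded_measurable M w" "\<And>y. 0 \<le> w y" "0 < gas_partition I w"
    and g: "\<And>j. j \<in> I \<Longrightarrow> bounded_measurable M (g j)" "\<And>j y. j \<in> I \<Longrightarrow> g j y \<in> {0..c}"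
    and c: "0 < c" and t: "0 < t"
  shows "measure (gas I w) {\<xi> \<in> space (gas I w). \<bar>(\<Sum>j\<in>I. g j (\<xi> j)) - gas_mean I w g\<bar> \<ge> t}
       \<le> 2 * exp (- (t\<^sup>2 / (2 * real (card I) * c\<^sup>2)))"
proof -
  interpret G: prob_space "gas I w" by (rule prob_space_gas) fact+
  let ?U = "\<lambda>g. {\<xi> \<in> space (gas I w). (\<Sum>j\<in>I. g j (\<xi> j)) \<ge> gas_mean I w g + t}"
  \<comment> \<open>The reflected statistic obeys the same bounds, and its upper tail is the lower
    tail of the original one.\<close>
  let ?g' = "\<lambda>j y. c - g j y"
  have bmg': "bounded_measurable M (?g' j)" if "j \<in> I" for j
    by (intro bounded_measurable_intros g that)
  have sum': "(\<Sum>j\<in>I. ?g' j (\<xi> j)) = real (card I) * c - (\<Sum>j\<in>I. g j (\<xi> j))" for \<xi>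
    by (simp add: sum_subtractf)
  have bmw: "bounded_measurable (prodM I) (gas_weight I w)"
    by (intro bounded_measurable_gas_weight assms)
  have bms: "bounded_measurable (prodM I) (\<lambda>\<xi>. gas_weight I w \<xi> * (\<Sum>j\<in>I. g j (\<xi> j)))"
    by (intro bounded_measurable_mult bmw bounded_measurable_linear_statistic g)
  note int = bounded_measurable_integrable[OF finite_measure_prodM]
  have mean': "gas_mean I w ?g' = real (card I) * c - gas_mean I w g"
    using int[OF bmw] int[OF bms] assms(5) unfolding gas_mean_def sum' right_diff_distrib
    by (simp add: gas_partition_def[symmetric] diff_divide_distrib)
  have meas: "?U h \<in> sets (gas I w)" if "\<And>j. j \<in> I \<Longrightarrow> bounded_measurable M (h j)" for h
  proof -
    have [measurable]: "(\<lambda>\<xi>. \<Sum>j\<in>I. h j (\<xi> j)) \<in> borel_measurable (prodM I)"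
      by (intro bounded_measurable_borel bounded_measurable_linear_statistic that)
    show ?thesis by measurable
  qed
  have "{\<xi> \<in> space (gas I w). \<bar>(\<Sum>j\<in>I. g j (\<xi> j)) - gas_mean I w g\<bar> \<ge> t} \<subseteq> ?U g \<union> ?U ?g'"
    unfolding sum' mean' by auto
  hence "measure (gas I w) {\<xi> \<in> space (gas I w). \<bar>(\<Sum>j\<in>I. g j (\<xi> j)) - gas_mean I w g\<bar> \<ge> t}
     \<le> measure (gas I w) (?U g \<union> ?U ?g')"
    by (intro G.finite_measure_mono sets.Un meas g bmg')
  also have "\<dots> \<le> measure (gas I w) (?U g) + measure (gas I w) (?U ?g')"
    by (intro measure_Un_le meas g bmg')
  also have "\<dots> \<le> exp (- (t\<^sup>2 / (2 * real (card I) * c\<^sup>2))) + exp (- (t\<^sup>2 / (2 * real (card I) * c\<^sup>2)))"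
    using g(2) by (intro add_mono gas_upper_tail assms bmg') auto
  finally show ?thesis by simp
qed

end

section \<open>The circular ensemble as a gas on the circle\<close>

definition circle_measure :: "real measure" where
  "circle_measure = uniform_measure lborel {0..2 * pi}"

lemma space_circle_measure [simp]: "space circle_measure = UNIV"
  by (simp add: circle_measure_def)

lemma borel_measurable_circle_measure [simp]:
  "borel_measurable circle_measure = borel_measurable borel"
  unfolding circle_measure_def by (rule measurable_cong_sets) simp_all

interpretation circle: vandermonde_gas circle_measure cis
proof -
  interpret prob_space circle_measure
    unfolding circle_measure_def by (rule prob_space_uniform_measure) auto
  show "vandermonde_gas circle_measure cis"
  proof
    show "bounded_measurable circle_measure cis"
      by (rule bounded_measurableI[where B = 1])
         (auto intro!: borel_measurable_continuous_onI continuous_intros)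
  qed
qed

lemma norm_cis_diff_power2: "(norm (cis a - cis b))\<^sup>2 = 4 * (sin ((a - b) / 2))\<^sup>2"
proof -
  have "(norm (cis a - cis b))\<^sup>2 = (cos a - cos b)\<^sup>2 + (sin a - sin b)\<^sup>2"
    by (simp add: cmod_power2)
  also have "\<dots> = 2 - 2 * cos (a - b)"
    using sin_cos_squared_add[of a] sin_cos_squared_add[of b]
    by (simp add: cos_diff power2_eq_square algebra_simps)
  also have "cos (a - b) = 1 - 2 * (sin ((a - b) / 2))\<^sup>2"
  proof -
    define d where "d = (a - b) / 2"
    have "a - b = 2 * d" by (simp add: d_def)
    thus ?thesis unfolding d_def[symmetric] by (simp only: cos_double_sin)
  qed
  finally show ?thesis by simp
qed

text \<open>Adding the largest index at each step turns the product over ordered pairs into squared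
  chord lengths over j < k.\<close>

lemma circle_vdm_sq:
  "circle.vdm_sq {1..n} \<Theta> = (\<Prod>k\<in>{1..n}. \<Prod>j\<in>{1..<k}. 4 * (sin ((\<Theta> k - \<Theta> j) / 2))\<^sup>2)"
proof (induction n)
  case 0
  thus ?case by (simp add: circle.vdm_sq_def)
next
  case (Suc n)
  have "circle.vdm_sq {1..Suc n} \<Theta> =
      circle.vdm_sq {1..n} \<Theta> * (\<Prod>j\<in>{1..n}. (norm (cis (\<Theta> (Suc n)) - cis (\<Theta> j)))\<^sup>2)"
    using circle.vdm_sq_insert[of "{1..n}" "Suc n" \<Theta> "\<Theta> (Suc n)"]
    by (simp add: atLeastAtMostSuc_conv)
  also have "{1..n} = {1..<Suc n}" by auto
  finally show ?case
    unfolding Suc.IH[folded atLeastLessThanSuc_atLeastAtMost]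
    by (simp add: norm_cis_diff_power2 atLeastLessThanSuc_atLeastAtMost atLeastAtMostSuc_conv)
qed

lemma circular_ensemble_eq_gas:
  "circular_ensemble Q n = circle.gas {1..n} (\<lambda>\<theta>. exp (- (real n * potential Q \<theta>)))"
proof -
  have weight: "ensemble_weight Q n = circle.gas_weight {1..n} (\<lambda>\<theta>. exp (- (real n * potential Q \<theta>)))"
    by (simp add: fun_eq_iff ensemble_weight_def circle.gas_weight_def circle_vdm_sq exp_sum
        sum_negf[symmetric] del: sum_negf One_nat_def)
  have haar: "haar_torus n = circle.prodM {1..n}"
    unfolding haar_torus_def circle_measure_def ..
  show ?thesis
    unfolding circular_ensemble_def partition_const_def circle.gas_def circle.gas_partition_def weight haar ..
qed

text \<open>The bound is needed on the whole line: continuity gives it on one period, and reducing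
  the angle with \<open>Arg2pi\<close> extends it.\<close>

lemma bounded_measurable_potential:
  assumes "C2_circle Q"
  shows "bounded_measurable circle_measure (potential Q)"
proof -
  have cont: "continuous_on UNIV (potential Q)"
    using assms unfolding C2_circle_def
    by (intro continuous_at_imp_continuous_on ballI differentiable_imp_continuous_within) auto
  have "compact (potential Q ` {0..2 * pi})"
    by (intro compact_continuous_image continuous_on_subset[OF cont]) auto
  then obtain B where B: "\<And>t. t \<in> {0..2 * pi} \<Longrightarrow> norm (potential Q t) \<le> B"
    by (meson bounded_iff compact_imp_bounded imageI)
  have "norm (potential Q t) \<le> B" for t
  proof -
    obtain s where "s \<in> {0..2 * pi}" "cis t = cis s"
    proof
      show "Arg2pi (cis t) \<in> {0..2 * pi}" using Arg2pi[of "cis t"] by auto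
      show "cis t = cis (Arg2pi (cis t))"
        using Arg2pi_eq[of "cis t"] by (simp add: cis_conv_exp)
    qed
    thus ?thesis using B[of s] by (simp add: potential_def)
  qed
  thus ?thesis
    by (intro bounded_measurableI) (auto intro: borel_measurable_continuous_onI cont)
qed

text \<open>Dropping the squared sine leaves sinh h / sinh^2(h/2) = 2 / tanh(h/2), which decreases
  in h and is therefore largest at \<open>\<eta>\<close>.\<close>

lemma poisson_kernel_bounds:
  fixes \<eta> h y :: real
  assumes "0 < \<eta>" "\<eta> \<le> h"
  shows "sinh h / ((sinh (h / 2))\<^sup>2 + (sin y)\<^sup>2) \<in> {0..2 / tanh (\<eta> / 2)}"
proof -
  have pos: "0 < sinh (h / 2)" "0 < cosh (h / 2)" using assms by simp_all
  have "sinh h / ((sinh (h / 2))\<^sup>2 + (sin y)\<^sup>2) \<le> sinh h / (sinh (h / 2))\<^sup>2"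
    using assms pos by (intro divide_left_mono) (auto intro!: mult_pos_pos add_pos_nonneg)
  also have "\<dots> = 2 / tanh (h / 2)"
    using sinh_double[of "h / 2"] pos by (simp add: tanh_def power2_eq_square)
  also have "\<dots> \<le> 2 / tanh (\<eta> / 2)"
    using assms by (intro divide_left_mono) auto
  finally show ?thesis using assms by simp
qed

theorem corollary6p4:
  fixes \<eta> :: real
  assumes "\<eta> > 0"
  shows "\<exists>\<kappa>::real. \<kappa> > 0 \<and>
    (\<forall>(Q :: complex \<Rightarrow> real) (n :: nat) (h :: nat \<Rightarrow> real) (x :: real) (s :: real).
       C2_circle Q \<longrightarrow> n \<ge> 1 \<longrightarrow> (\<forall>j\<in>{1..n}. h j \<ge> \<eta>) \<longrightarrow> s > 0 \<longrightarrow>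
       measure (circular_ensemble Q n)
         {\<Theta> \<in> torus n.
            \<bar>poisson_average n h x \<Theta> - (\<integral>\<Phi>. poisson_average n h x \<Phi> \<partial>circular_ensemble Q n)\<bar>
              \<ge> s / sqrt (real n)}
       \<le> 2 * exp (- (s\<^sup>2 / (4 * \<kappa>))))"
proof -
  define c where "c = 2 / tanh (\<eta> / 2)"
  have c: "0 < c" using assms by (simp add: c_def)
  show ?thesis
  \<comment> \<open>With t = s sqrt(n) the gas bound has exponent -s^2 / (2 c^2), which equals -s^2
    / (4 \<kappa>) for this \<kappa>. It depends on \<open>\<eta>\<close> alone, through
    \<open>c\<close>.\<close>
  proof (intro exI[of _ "c\<^sup>2 / 2"] conjI allI impI)
    show "0 < c\<^sup>2 / 2" using c by simp
  next
    fix Q :: "complex \<Rightarrow> real" and n :: nat and h :: "nat \<Rightarrow> real" and x s :: real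
    assume Q: "C2_circle Q" and n: "n \<ge> 1" and h: "\<forall>j\<in>{1..n}. h j \<ge> \<eta>" and s: "s > 0"
    define w where "w = (\<lambda>\<theta>. exp (- (real n * potential Q \<theta>)))"
    define g where "g = (\<lambda>j \<theta>. sinh (h j) / ((sinh (h j / 2))\<^sup>2 + (sin ((x - \<theta>) / 2))\<^sup>2))"
    let ?\<mu> = "circle.gas {1..n} w"
    have ens: "circular_ensemble Q n = ?\<mu>" unfolding w_def by (rule circular_ensemble_eq_gas)
    have w_nonneg: "0 \<le> w y" for y by (simp add: w_def)
    have "bounded_measurable circle_measure (\<lambda>\<theta>. exp (0 - real n * potential Q \<theta>))"
      by (intro bounded_measurable_intros bounded_measurable_potential Q)
    hence bmw: "bounded_measurable circle_measure w" by (simp add: w_def)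
    have g_bounds: "g j y \<in> {0..c}" if "j \<in> {1..n}" for j y
      unfolding g_def c_def using h that by (intro poisson_kernel_bounds assms) auto
    have bmg: "bounded_measurable circle_measure (g j)" if j: "j \<in> {1..n}" for j
    proof (rule bounded_measurableI[where B = c])
      show "norm (g j y) \<le> c" for y using g_bounds[OF j, of y] by simp
      show "g j \<in> borel_measurable circle_measure"
        unfolding g_def by simp
    qed
    have avg: "poisson_average n h x \<Theta> = (\<Sum>j\<in>{1..n}. g j (\<Theta> j)) / real n" for \<Theta>
      by (simp add: poisson_average_def g_def)
    have bms: "bounded_measurable (circle.prodM {1..n}) (\<lambda>\<Theta>. \<Sum>j\<in>{1..n}. g j (\<Theta> j))"
      by (intro circle.bounded_measurable_linear_statistic bmg)
    hence [measurable]: "(\<lambda>\<Theta>. \<Sum>j\<in>{1..n}. g j (\<Theta> j)) \<in> borel_measurable (circle.prodM {1..n})"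
      by (rule bounded_measurable_borel)
    have mean: "(\<integral>\<Phi>. poisson_average n h x \<Phi> \<partial>?\<mu>) = circle.gas_mean {1..n} w g / real n"
      unfolding avg circle.gas_mean_def
      by (simp add: circle.integral_gas[OF bmw w_nonneg bounded_measurable_borel[OF bms]]
          del: One_nat_def)
    show "measure (circular_ensemble Q n)
         {\<Theta> \<in> torus n.
            \<bar>poisson_average n h x \<Theta> - (\<integral>\<Phi>. poisson_average n h x \<Phi> \<partial>circular_ensemble Q n)\<bar>
              \<ge> s / sqrt (real n)}
       \<le> 2 * exp (- (s\<^sup>2 / (4 * (c\<^sup>2 / 2))))" (is "measure _ ?A \<le> _")
    proof (cases "circle.gas_partition {1..n} w = 0")
      case True
      \<comment> \<open>Division by 0 makes the density 0, so the measure is null and the bound is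
        trivial.\<close>
      hence "circular_ensemble Q n = null_measure (circle.prodM {1..n})"
        unfolding ens circle.gas_def
        by (intro measure_eqI) (simp_all add: emeasure_density)
      thus ?thesis by simp
    next
      case False
      hence pos: "0 < circle.gas_partition {1..n} w"
        using circle.gas_partition_nonneg[of w "{1..n}"] w_nonneg by (simp add: order_less_le)
      interpret G: prob_space ?\<mu>
        by (rule circle.prob_space_gas[OF bmw w_nonneg pos])
      \<comment> \<open>Scaling by n turns the threshold s / sqrt(n) for the average into s sqrt(n)
        for the sum.\<close>
      let ?B = "{\<Theta> \<in> space ?\<mu>.
        \<bar>(\<Sum>j\<in>{1..n}. g j (\<Theta> j)) - circle.gas_mean {1..n} w g\<bar> \<ge> s * sqrt (real n)}"
      have "?A \<subseteq> ?B"
      proof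
        fix \<Theta> assume A: "\<Theta> \<in> ?A"
        have "torus n \<subseteq> space ?\<mu>"
          by (auto simp: torus_def space_PiM)
        moreover have "s / sqrt (real n) \<le>
            \<bar>(\<Sum>j\<in>{1..n}. g j (\<Theta> j)) - circle.gas_mean {1..n} w g\<bar> / real n"
        proof -
          have "s / sqrt (real n) \<le> \<bar>poisson_average n h x \<Theta> - circle.gas_mean {1..n} w g / real n\<bar>"
            using A unfolding ens mean by blast
          thus ?thesis by (simp add: avg diff_divide_distrib[symmetric] abs_divide)
        qed
        moreover have "s / sqrt (real n) = s * sqrt (real n) / real n"
          using sqrt_divide_self_eq[of "real n"] by (simp add: times_divide_eq_right[symmetric] divide_inverse del: times_divide_eq_right)
        ultimately show "\<Theta> \<in> ?B" using A n by (auto simp: divide_le_cancel)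
      qed
      hence "measure ?\<mu> ?A \<le> measure ?\<mu> ?B"
        by (intro G.finite_measure_mono) measurable
      also have "\<dots> \<le> 2 * exp (- ((s * sqrt (real n))\<^sup>2 / (2 * real (card {1..n}) * c\<^sup>2)))"
        using n s by (intro circle.gas_concentration bmw w_nonneg pos bmg g_bounds c) auto
      also have "(s * sqrt (real n))\<^sup>2 / (2 * real (card {1..n}) * c\<^sup>2) = s\<^sup>2 / (4 * (c\<^sup>2 / 2))"
        using n by (simp add: power_mult_distrib)
      finally show ?thesis unfolding ens .
    qed
  qed
qed

end
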